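(* Let $P, R, J \geq 1$ be integers, let $I_1, \ldots, I_P$ be positive integers that are powers of two, and let $\tilde{I} = I_1 I_2 \cdots I_P$. Let $\varepsilon \in (0,1)$ and $\delta \in (0,1)$. Let $\mathbf{X} = [\mathbf{x}_1, \mathbf{x}_2, \ldots, \mathbf{x}_R] \in \mathbb{R}^{\tilde{I} \times R}$ be a (fixed) matrix each of whose columns is a Kronecker vector, $\mathbf{x}_r = \mathbf{x}_r^{(1)} \otimes \mathbf{x}_r^{(2)} \otimes \cdots \otimes \mathbf{x}_r^{(P)}$ with $\mathbf{x}_r^{(p)} \in \mathbb{R}^{I_p}$ for each $p \in \{1,\ldots,P\}$ and $r \in \{1,\ldots,R\}$. For each $p \in \{1,\ldots,P\}$, let $\mathbf{H}^{(p)} \mathbf{D}^{(p)}$ be independent randomized Hadamard transforms of size $I_p \times I_p$, and define $$\mathbf{\Phi} = \bigotimes_{p=1}^P \mathbf{H}^{(p)} \mathbf{D}^{(p)} \in \mathbb{R}^{\tilde{I} \times \tilde{I}}.$$ Let $\mathbf{S}_{\mathbf{q}} \in \mathbb{R}^{J \times \tilde{I}}$ be the uniform sampling matrix, independent of $\mathbf{D}^{(1)}, \ldots, \mathbf{D}^{(P)}$. If $$J > \frac{8}{3} \cdot 2^{P} R^{P+1} \varepsilon^{-2} \ln \Big( \frac{2 R (P+1)}{\delta} \Big) \prod_{p=1}^P \ln\Big(\frac{2 I_p R (P+1)}{\delta}\Big),$$ then with probability at least $1-\delta$ the following holds: $$(\forall \mathbf{z} \in \mathbb{R}^R) \quad (1-\varepsilon)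 \|\mathbf{X} \mathbf{z}\|_2^2 \leq \|\mathbf{S}_{\mathbf{q}} \mathbf{\Phi} \mathbf{X} \mathbf{z}\|_2^2 \leq (1+\varepsilon) \|\mathbf{X} \mathbf{z}\|_2^2.$$
   Context: $\otimes$ denotes the Kronecker product of matrices (and of column vectors), $\|\cdot\|_2$ is the Euclidean norm, and $\ln$ is the natural logarithm. Randomized Hadamard transform: for $I$ a power of two, let $\mathbf{H} \in \mathbb{R}^{I \times I}$ be the normalized Hadamard matrix, i.e. the orthogonal matrix defined by $\mathbf{H}_1 = [1]$ and $\mathbf{H}_{2n} = \frac{1}{\sqrt{2}} \begin{bmatrix} \mathbf{H}_n & \mathbf{H}_n \\ \mathbf{H}_n & -\mathbf{H}_n \end{bmatrix}$ (all entries are $\pm 1/\sqrt{I}$). Let $\mathbf{D} \in \mathbb{R}^{I \times I}$ be a random diagonal matrix whose diagonal entries are i.i.d. Rademacher random variables (equal to $+1$ or $-1$ with probability $1/2$ each). The $I \times I$ randomized Hadamard transform is the random matrix $\mathbf{H}\mathbf{D}$. Uniform sampling matrix: let $v_1, \ldots, v_J$ be independent random indices, each uniformly distributed on $\{1, \ldots, \tilde{I}\}$ (sampling with replacement), i.e. with distribution $\mathbf{q} = (1/\tilde{I}, \ldots, 1/\tilde{I})$. Then $\mathbf{S}_{\mathbf{q}} \in \mathbb{R}^{J \times \tilde{I}}$ is the random matrix whose $j$th row is $\sqrt{\tilde{I}/J}\; \mathbf{e}_{v_j}^\top$, where $\mathbf{e}_i$ is the $i$th column of the $\tilde{I} \times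 \tilde{I}$ identity matrix. *)

theory Defs
  imports "HOL-Probability.Probability" "Jordan_Normal_Form.Matrix"
begin

unbundle no vec_syntax
hide_const (open) Finite_Cartesian_Product.vec Finite_Cartesian_Product.mat
  Finite_Cartesian_Product.row Finite_Cartesian_Product.column

definition kron_mat :: "real mat \<Rightarrow> real mat \<Rightarrow> real mat" where
  "kron_mat A B = Matrix.mat (dim_row A * dim_row B) (dim_col A * dim_col B)
     (\<lambda>(i, j). A $$ (i div dim_row B, j div dim_col B) * B $$ (i mod dim_row B, j mod dim_col B))"

definition kron_vec :: "real Matrix.vec \<Rightarrow> real Matrix.vec \<Rightarrow> real Matrix.vec" where
  "kron_vec a b = Matrix.vec (dim_vec a * dim_vec b)
     (\<lambda>i. a $ (i div dim_vec b) * b $ (i mod dim_vec b))"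

text \<open>The iterated product of the factors with indices \<open>0, \<dots>, P - 1\<close>, in this order; the
  empty product is the unit of the Kronecker product.\<close>

primrec kron_mats :: "(nat \<Rightarrow> real mat) \<Rightarrow> nat \<Rightarrow> real mat" where
  "kron_mats A 0 = 1\<^sub>m 1"
| "kron_mats A (Suc P) = kron_mat (kron_mats A P) (A P)"

primrec kron_vecs :: "(nat \<Rightarrow> real Matrix.vec) \<Rightarrow> nat \<Rightarrow> real Matrix.vec" where
  "kron_vecs a 0 = unit_vec 1 0"
| "kron_vecs a (Suc P) = kron_vec (kron_vecs a P) (a P)"

text \<open>The argument is the exponent: \<open>hadamard k\<close> is the normalized Hadamard matrix of
  size \<open>2 ^ k\<close>.\<close>

primrec hadamard :: "nat \<Rightarrow> real mat" where
  "hadamard 0 = 1\<^sub>m 1"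
| "hadamard (Suc k) = (1 / sqrt 2) \<cdot>\<^sub>m
     four_block_mat (hadamard k) (hadamard k) (hadamard k) (- hadamard k)"

text \<open>The \<open>J \<times> N\<close> matrix that samples the rows \<open>v 0, \<dots>, v (J - 1)\<close>, numbered from \<open>0\<close>,
  rescaled for uniform sampling.\<close>

definition sampling_mat :: "nat \<Rightarrow> nat \<Rightarrow> (nat \<Rightarrow> nat) \<Rightarrow> real mat" where
  "sampling_mat J N v =
     mat_of_rows N (map (\<lambda>j. sqrt (real N / real J) \<cdot>\<^sub>v unit_vec N (v j)) [0..<J])"

text \<open>The library's \<^const>\<open>prob_space.indep_var\<close> needs two variables with the same value type; this
  is its characterization \<open>indep_var_eq\<close> without that restriction.\<close>

definition indep_rvs :: "'w measure \<Rightarrow> 'a measure \<Rightarrow> ('w \<Rightarrow> 'a) \<Rightarrow> 'b measure \<Rightarrow> ('w \<Rightarrow> 'b) \<Rightarrow> bool"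
  where
  "indep_rvs M K X L Y \<longleftrightarrow> X \<in> measurable M K \<and> Y \<in> measurable M L \<and>
     prob_space.indep_set M
       (sigma_sets (space M) {X -` A \<inter> space M | A. A \<in> sets K})
       (sigma_sets (space M) {Y -` A \<inter> space M | A. A \<in> sets L})"

definition norm2 :: "real Matrix.vec \<Rightarrow> real" where
  "norm2 x = L2_set (\<lambda>i. x $ i) {..<dim_vec x}"

lemma indep_rvs_iff_indep_var:
  "prob_space M \<Longrightarrow> indep_rvs M K X L Y \<longleftrightarrow> prob_space.indep_var M K X L Y"
  by (simp add: indep_rvs_def prob_space.indep_var_eq)

lemma hadamard_carrier: "hadamard k \<in> carrier_mat (2 ^ k) (2 ^ k)"
proof (induction k)
  case (Suc k)
  then have "dim_row (hadamard k) = 2 ^ k" "dim_col (hadamard k) = 2 ^ k"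
    by auto
  then show ?case
    by (intro carrier_matI) simp_all
qed simp

lemma kron_mats_carrier:
  assumes "\<And>p. p < P \<Longrightarrow> A p \<in> carrier_mat (m p) (n p)"
  shows "kron_mats A P \<in> carrier_mat (\<Prod>p<P. m p) (\<Prod>p<P. n p)"
  using assms
proof (induction P)
  case (Suc P)
  have "kron_mats A P \<in> carrier_mat (\<Prod>p<P. m p) (\<Prod>p<P. n p)" "A P \<in> carrier_mat (m P) (n P)"
    using Suc by simp_all
  then show ?case
    by (intro carrier_matI) (simp_all add: kron_mat_def)
qed simp

lemma kron_vecs_carrier:
  assumes "\<And>p. p < P \<Longrightarrow> a p \<in> carrier_vec (n p)"
  shows "kron_vecs a P \<in> carrier_vec (\<Prod>p<P. n p)"
  using assms
proof (induction P)
  case (Suc P)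
  have "kron_vecs a P \<in> carrier_vec (\<Prod>p<P. n p)" "a P \<in> carrier_vec (n P)"
    using Suc by simp_all
  then show ?case
    by (intro carrier_vecI) (simp add: kron_vec_def)
qed simp

end

theory Submission
  imports Defs
begin

text \<open>
Write \<open>W = \<Phi> X\<close> and \<open>N\<close> for the product of the sizes \<open>I p\<close>. Uniform sampling of the rows of \<open>W\<close>
preserves norms when no row has a large leverage score, that is, when \<open>(W z)\<^sub>i\<^sup>2 \<le> c \<parallel>W z\<parallel>\<^sup>2\<close> holds for
all \<open>z\<close> and \<open>i\<close> with \<open>c\<close> not much larger than \<open>1 / N\<close>. The proof first shows that \<open>\<Phi>\<close> produces such a
\<open>W\<close> with high probability, and then that sampling works for every fixed such \<open>W\<close>.

Leverage. For a single factor, expand the at most \<open>R\<close>-dimensional span of the vectors \<open>x r p\<close> in an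
orthonormal basis. Each entry of a transformed basis vector is a Rademacher sum whose squared
coefficients add up to \<open>1 / I p\<close>; Hoeffding's inequality and a union bound over the at most
\<open>R * I p\<close> entries give the leverage bound \<open>2 R ln (2 R (I p) (P + 1) / \<delta>) / I p\<close> outside an event of
probability at most \<open>\<delta> / (P + 1)\<close> (\<open>rand_hadamard_leverage\<close>). Leverage bounds multiply under the Kronecker
product: view a combination of vectors \<open>a\<^sub>r \<otimes> b\<^sub>r\<close> as a matrix whose rows are combinations of the
\<open>b\<^sub>r\<close> and whose columns are combinations of the \<open>a\<^sub>r\<close>, and apply the two bounds one after the other
(\<open>leverage_le_kron_vec\<close>). So \<open>W\<close> has leverage bound \<open>B / N\<close> with
\<open>B = 2\<^sup>P R\<^sup>P \<Prod>\<^sub>p ln (2 R (I p) (P + 1) / \<delta>)\<close>.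

Sampling. Let \<open>q\<^sub>i\<close> be the rows of a matrix with orthonormal columns that span the range of \<open>W\<close>. The
matrices \<open>Y\<^sub>i = N q\<^sub>i q\<^sub>i\<^sup>T - 1\<close> average to zero, their Frobenius norms are at most \<open>B\<close> and the squares
of these norms average to at most \<open>B R\<close>. If the sum of \<open>J\<close> samples of \<open>Y\<close> has Frobenius norm below
\<open>J \<epsilon>\<close>, then the two inequalities hold for all \<open>z\<close> at once (\<open>sampling_embedding_count\<close>). A Bernstein
inequality for vectors bounds the probability of the contrary by \<open>2 exp (- 3 J \<epsilon>\<^sup>2 / (8 B R))\<close>, which is
at most \<open>\<delta> / (P + 1)\<close>. The factor \<open>R\<close> next to \<open>B\<close> is the price of controlling the
Frobenius norm in place of the operator norm.

The Bernstein inequality (\<open>vector_Bernstein_count\<close>) follows Pinelis: instead of the exponential of a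
scalar sum, its proof controls the mean of \<open>cosh \<parallel>S\<parallel>\<close> as the sum \<open>S\<close> grows by one term at a time. The
convexity of \<open>cosh (sqrt u)\<close> replaces the usual second order expansion. Samples are
counted, not integrated: all sample sequences are equally likely.
\<close>

section \<open>Orthonormal bases of spans of real functions\<close>

lemma sum_squares_orthonormal:
  fixes q :: "nat \<Rightarrow> 'a \<Rightarrow> real"
  assumes orth: "\<And>k l. k < K \<Longrightarrow> l < K \<Longrightarrow> (\<Sum>i\<in>A. q k i * q l i) = (if k = l then 1 else 0)"
  shows "(\<Sum>i\<in>A. (\<Sum>k<K. c k * q k i)\<^sup>2) = (\<Sum>k<K. (c k)\<^sup>2)"
proof -
  have "(\<Sum>i\<in>A. (\<Sum>k<K. c k * q k i)\<^sup>2)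
      = (\<Sum>i\<in>A. \<Sum>k<K. \<Sum>l<K. (c k * c l) * (q k i * q l i))"
    by (simp add: power2_eq_square sum_product mult_ac)
  also have "\<dots> = (\<Sum>k<K. \<Sum>l<K. \<Sum>i\<in>A. (c k * c l) * (q k i * q l i))"
    by (subst sum.swap, intro sum.cong refl, subst sum.swap, rule refl)
  also have "\<dots> = (\<Sum>k<K. \<Sum>l<K. if l = k then (c k)\<^sup>2 else 0)"
    by (intro sum.cong refl) (simp add: orth power2_eq_square flip: sum_distrib_left)
  also have "\<dots> = (\<Sum>k<K. (c k)\<^sup>2)"
    by simp
  finally show ?thesis .
qed

text \<open>Gram and Schmidt: coordinates transfer in both directions, so that a statement about all
combinations of the \<open>b r\<close> becomes one about all coefficient vectors \<open>c\<close>, and a basis vector can be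
plugged into a hypothesis on combinations of the \<open>b r\<close>. The number \<open>K\<close> of basis vectors is the
dimension of the span.\<close>

lemma orthonormal_basis_exists:
  fixes b :: "nat \<Rightarrow> 'a \<Rightarrow> real"
  assumes A: "finite A"
  obtains K q t c where "K \<le> R"
    and "\<And>k l. k < K \<Longrightarrow> l < K \<Longrightarrow> (\<Sum>i\<in>A. q k i * q l i) = (if k = l then 1 else 0)"
    and "\<And>k i. k < K \<Longrightarrow> i \<in> A \<Longrightarrow> q k i = (\<Sum>r<R. t k r * b r i)"
    and "\<And>z i. i \<in> A \<Longrightarrow> (\<Sum>r<R. z r * b r i) = (\<Sum>k<K. c z k * q k i)"
proof -
  have "\<exists>K\<le>R. \<exists>q t c.
      (\<forall>k<K. \<forall>l<K. (\<Sum>i\<in>A. q k i * q l i) = (if k = l then 1 else 0)) \<and>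
      (\<forall>k<K. \<forall>i\<in>A. q k i = (\<Sum>r<R. t k r * b r i)) \<and>
      (\<forall>z. \<forall>i\<in>A. (\<Sum>r<R. z r * b r i) = (\<Sum>k<K. c z k * q k i))"
  proof (induction R)
    case 0
    show ?case by (rule exI[of _ 0]) simp
  next
    case (Suc R)
    then obtain K q t c where K: "K \<le> R"
      and orth: "\<And>k l. k < K \<Longrightarrow> l < K \<Longrightarrow> (\<Sum>i\<in>A. q k i * q l i) = (if k = l then 1 else (0::real))"
      and qt: "\<And>k i. k < K \<Longrightarrow> i \<in> A \<Longrightarrow> q k i = (\<Sum>r<R. t k r * b r i)"
      and bc: "\<And>z i. i \<in> A \<Longrightarrow> (\<Sum>r<R. z r * b r i) = (\<Sum>k<K. c z k * q k i)"
      by blast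
    define p where "p k = (\<Sum>i\<in>A. b R i * q k i)" for k
    define u where "u i = b R i - (\<Sum>k<K. p k * q k i)" for i
    define s where "s = sqrt (\<Sum>i\<in>A. (u i)\<^sup>2)"
    have u_orth: "(\<Sum>i\<in>A. u i * q l i) = 0" if "l < K" for l
    proof -
      have "(\<Sum>i\<in>A. u i * q l i) = p l - (\<Sum>i\<in>A. \<Sum>k<K. p k * (q k i * q l i))"
        by (simp add: u_def p_def[of l] left_diff_distrib sum_subtractf sum_distrib_right mult.assoc)
      also have "(\<Sum>i\<in>A. \<Sum>k<K. p k * (q k i * q l i)) = (\<Sum>k<K. \<Sum>i\<in>A. p k * (q k i * q l i))"
        by (rule sum.swap)
      also have "\<dots> = (\<Sum>k<K. if k = l then p k else 0)"
        using that by (intro sum.cong refl) (simp add: orth flip: sum_distrib_left)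
      also have "\<dots> = p l"
        using that by simp
      finally show ?thesis by simp
    qed
    show ?case
    \<comment> \<open>The residual \<open>u\<close> vanishes exactly when \<open>b R\<close> adds no new dimension.\<close>
    proof (cases "s = 0")
      case True
      then have "u i = 0" if "i \<in> A" for i
        using that A by (simp add: s_def sum_nonneg_eq_0_iff)
      then have bR: "b R i = (\<Sum>k<K. p k * q k i)" if "i \<in> A" for i
        using that by (simp add: u_def)
      have o2: "q k i = (\<Sum>r<Suc R. (if r < R then t k r else 0) * b r i)" if "k < K" "i \<in> A" for k i
        using qt[OF that] by simp
      have o3: "(\<Sum>r<Suc R. z r * b r i) = (\<Sum>k<K. (c z k + z R * p k) * q k i)" if "i \<in> A" for z i
        using bc[OF that, of z] bR[OF that]
        by (simp add: distrib_right sum.distrib sum_distrib_left mult.assoc)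
      show ?thesis
      proof (rule exI[of _ K], rule conjI, use K in simp, rule exI[of _ q],
          rule exI[of _ "\<lambda>k r. if r < R then t k r else 0"], rule exI[of _ "\<lambda>z k. c z k + z R * p k"],
          intro conjI allI impI ballI)
      qed (fact orth o2 o3)+
    next
      case False
      have s2: "(\<Sum>i\<in>A. u i * u i) = s * s"
        by (simp add: s_def power2_eq_square sum_nonneg)
      define q' where "q' k i = (if k < K then q k i else u i / s)" for k i
      define t' where "t' k r = (if k < K then if r < R then t k r else 0
          else if r < R then - (\<Sum>k<K. p k * t k r) / s else 1 / s)" for k r
      define c' where "c' z k = (if k < K then c z k + z R * p k else z R * s)" for z k
      have o1: "(\<Sum>i\<in>A. q' k i * q' l i) = (if k = l then 1 else 0)" if "k < Suc K" "l < Suc K" for k l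
      proof -
        have 1: "(\<Sum>i\<in>A. u i * q l i / s) = 0" if "l < K" for l
          using u_orth[OF that] by (simp flip: sum_divide_distrib)
        have 2: "(\<Sum>i\<in>A. u i * u i / (s * s)) = 1"
          using s2 False by (simp flip: sum_divide_distrib)
        show ?thesis
          using that 1 2 orth by (auto simp: q'_def less_Suc_eq mult.commute)
      qed
      have o2: "q' k i = (\<Sum>r<Suc R. t' k r * b r i)" if "k < Suc K" "i \<in> A" for k i
      proof (cases "k < K")
        case True
        then show ?thesis using that by (simp add: q'_def t'_def qt)
      next
        case k: False
        have "(\<Sum>k<K. p k * q k i) = (\<Sum>k<K. \<Sum>r<R. p k * t k r * b r i)"
          using that by (simp add: qt sum_distrib_left mult_ac)
        also have "\<dots> = (\<Sum>r<R. (\<Sum>k<K. p k * t k r) * b r i)"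
          by (subst sum.swap) (simp add: sum_distrib_right)
        finally have "u i = b R i - (\<Sum>r<R. (\<Sum>k<K. p k * t k r) * b r i)"
          by (simp add: u_def)
        then show ?thesis using k
          by (simp add: q'_def t'_def diff_divide_distrib sum_negf flip: sum_divide_distrib)
      qed
      have o3: "(\<Sum>r<Suc R. z r * b r i) = (\<Sum>k<Suc K. c' z k * q' k i)" if "i \<in> A" for z i
      proof -
        have "z R * b R i = (\<Sum>k<K. z R * p k * q k i) + z R * u i"
          by (simp add: u_def right_diff_distrib sum_distrib_left mult.assoc)
        then show ?thesis
          using False bc[OF that, of z] by (simp add: c'_def q'_def distrib_right sum.distrib)
      qed
      show ?thesis
      proof (rule exI[of _ "Suc K"], rule conjI, use K in simp, rule exI[of _ q'],
          rule exI[of _ t'], rule exI[of _ c'], intro conjI allI impI ballI)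
      qed (fact o1 o2 o3)+
    qed
  qed
  then obtain K q t c where "K \<le> R"
    and "\<forall>k<K. \<forall>l<K. (\<Sum>i\<in>A. q k i * q l i) = (if k = l then 1 else 0)"
    and "\<forall>k<K. \<forall>i\<in>A. q k i = (\<Sum>r<R. t k r * b r i)"
    and "\<forall>z. \<forall>i\<in>A. (\<Sum>r<R. z r * b r i) = (\<Sum>k<K. c z k * q k i)"
    by (elim exE conjE)
  then show thesis by (intro that[of K q t c]) blast+
qed

section \<open>A Bernstein inequality for vectors\<close>

lemma cosh_sqrt_series: "cosh (sqrt u) = (\<Sum>n. u ^ n / fact (2 * n))" "summable (\<lambda>n. u ^ n / fact (2 * n))"
  if "u \<ge> 0" for u :: real
proof -
  have "(\<lambda>n. (if even n then sqrt u ^ n /\<^sub>R fact n else 0)) sums cosh (sqrt u)"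
    by (rule cosh_converges)
  moreover have "strict_mono (\<lambda>n::nat. 2 * n)" by (simp add: strict_mono_def)
  ultimately have "(\<lambda>n. (if even (2 * n) then sqrt u ^ (2 * n) /\<^sub>R fact (2 * n) else 0)) sums cosh (sqrt u)"
    by (subst sums_mono_reindex) (auto elim!: evenE)
  then have "(\<lambda>n. u ^ n / fact (2 * n)) sums cosh (sqrt u)"
    using that by (simp add: power_mult power_mult_distrib[symmetric] real_sqrt_pow2 divide_inverse mult.commute[of "inverse _"])
  then show "cosh (sqrt u) = (\<Sum>n. u ^ n / fact (2 * n))" "summable (\<lambda>n. u ^ n / fact (2 * n))"
    by (auto simp: sums_iff)
qed

text \<open>All coefficients of the power series of \<open>cosh (sqrt u)\<close> in \<open>u\<close> are positive, and every power is
convex on the nonnegative half-line.\<close>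

lemma convex_on_cosh_sqrt: "convex_on {0..} (\<lambda>u::real. cosh (sqrt u))"
proof (rule convex_onI)
  fix t x y :: real
  assume t: "0 < t" "t < 1" and xy: "x \<in> {0..}" "y \<in> {0..}"
  have pw: "convex_on {0..} (\<lambda>x::real. x ^ n)" for n
  proof (cases "even n")
    case True
    then show ?thesis by (rule convex_on_subset[OF convex_power_even]) auto
  qed (rule convex_power_odd)
  let ?w = "(1 - t) *\<^sub>R x + t *\<^sub>R y"
  have w: "?w \<ge> 0" using t xy by auto
  have "cosh (sqrt ?w) = (\<Sum>n. ?w ^ n / fact (2 * n))"
    by (rule cosh_sqrt_series[OF w])
  also have "\<dots> \<le> (\<Sum>n. (1 - t) * (x ^ n / fact (2 * n)) + t * (y ^ n / fact (2 * n)))"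
  proof (rule suminf_le)
    fix n
    have "?w ^ n \<le> (1 - t) * x ^ n + t * y ^ n"
      using convex_onD[OF pw, of t x y n] t xy by simp
    then have "?w ^ n / fact (2 * n) \<le> ((1 - t) * x ^ n + t * y ^ n) / fact (2 * n)"
      by (rule divide_right_mono) simp
    then show "?w ^ n / fact (2 * n) \<le> (1 - t) * (x ^ n / fact (2 * n)) + t * (y ^ n / fact (2 * n))"
      by (simp add: add_divide_distrib)
  next
    show "summable (\<lambda>n. ?w ^ n / fact (2 * n))"
      by (rule cosh_sqrt_series[OF w])
    show "summable (\<lambda>n. (1 - t) * (x ^ n / fact (2 * n)) + t * (y ^ n / fact (2 * n)))"
      using xy by (intro summable_add summable_mult cosh_sqrt_series) auto
  qed
  also have "\<dots> = (1 - t) * cosh (sqrt x) + t * cosh (sqrt y)"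
    using xy cosh_sqrt_series[of x] cosh_sqrt_series[of y]
    by (simp only: suminf_add[symmetric] suminf_mult summable_mult atLeast_iff)
  finally show "cosh (sqrt ?w) \<le> (1 - t) * cosh (sqrt x) + t * cosh (sqrt y)" .
qed auto

text \<open>For given norms \<open>\<alpha>\<close> and \<open>\<beta>\<close> of \<open>a\<close> and \<open>b\<close>, the squared norm of \<open>a + b\<close> is an affine function of the inner
product, which lies between \<open>- \<alpha> \<beta>\<close> and \<open>\<alpha> \<beta>\<close>. Hence \<open>cosh \<parallel>a + b\<parallel>\<close> is convex in the inner product and
lies below the chord, whose end points are the values for parallel and antiparallel vectors. When a
norm vanishes, so does the inner product, and the quotients \<open>sinh 0 / 0 = 0\<close> are harmless.\<close>

lemma cosh_L2_set_add_le:
  fixes a b :: "'t \<Rightarrow> real"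
  shows "cosh (L2_set (\<lambda>s. a s + b s) T)
    \<le> cosh (L2_set a T) * cosh (L2_set b T)
       + (\<Sum>s\<in>T. a s * b s) * (sinh (L2_set a T) / L2_set a T) * (sinh (L2_set b T) / L2_set b T)"
proof -
  let ?\<alpha> = "L2_set a T" and ?\<beta> = "L2_set b T" and ?c = "\<Sum>s\<in>T. a s * b s"
  have sq: "(L2_set f T)\<^sup>2 = (\<Sum>s\<in>T. (f s)\<^sup>2)" for f :: "'t \<Rightarrow> real"
    by (simp add: L2_set_def sum_nonneg)
  have expand: "(L2_set (\<lambda>s. a s + b s) T)\<^sup>2 = ?\<alpha>\<^sup>2 + ?\<beta>\<^sup>2 + 2 * ?c"
    by (simp add: sq power2_sum sum.distrib sum_distrib_left mult_ac)
  have c: "\<bar>?c\<bar> \<le> ?\<alpha> * ?\<beta>"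
    using sum_abs[of "\<lambda>s. a s * b s" T] L2_set_mult_ineq[of a b T] by (simp add: abs_mult)
  show ?thesis
  proof (cases "?\<alpha> * ?\<beta> = 0")
    case True
    then have "?c = 0" using c by auto
    with expand True have "(L2_set (\<lambda>s. a s + b s) T)\<^sup>2 = (?\<alpha> + ?\<beta>)\<^sup>2"
      by (simp add: power2_sum)
    then have "L2_set (\<lambda>s. a s + b s) T = ?\<alpha> + ?\<beta>"
      by (subst (asm) power2_eq_iff_nonneg) simp_all
    then show ?thesis using True \<open>?c = 0\<close> by auto
  next
    case False
    then have pos: "?\<alpha> > 0" "?\<beta> > 0"
      by (simp_all add: order_less_le)
    define t where "t = (1 + ?c / (?\<alpha> * ?\<beta>)) / 2"
    have "\<bar>?c / (?\<alpha> * ?\<beta>)\<bar> \<le> 1" using c pos by (simp add: abs_mult)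
    then have t: "0 \<le> t" "t \<le> 1" unfolding t_def abs_le_iff by simp_all
    have "(L2_set (\<lambda>s. a s + b s) T)\<^sup>2 = (1 - t) * (?\<alpha> - ?\<beta>)\<^sup>2 + t * (?\<alpha> + ?\<beta>)\<^sup>2"
      unfolding expand t_def using pos by (simp add: field_simps power2_eq_square)
    then have "L2_set (\<lambda>s. a s + b s) T = sqrt ((1 - t) * (?\<alpha> - ?\<beta>)\<^sup>2 + t * (?\<alpha> + ?\<beta>)\<^sup>2)"
      by (metis L2_set_nonneg real_sqrt_unique)
    also have "cosh \<dots> \<le> (1 - t) * cosh (sqrt ((?\<alpha> - ?\<beta>)\<^sup>2)) + t * cosh (sqrt ((?\<alpha> + ?\<beta>)\<^sup>2))"
      using convex_onD[OF convex_on_cosh_sqrt t, of "(?\<alpha> - ?\<beta>)\<^sup>2" "(?\<alpha> + ?\<beta>)\<^sup>2"] by simp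
    also have "\<dots> = (1 - t) * cosh (?\<alpha> - ?\<beta>) + t * cosh (?\<alpha> + ?\<beta>)"
      by (simp add: cosh_real_abs)
    also have "\<dots> = cosh ?\<alpha> * cosh ?\<beta> + (2 * t - 1) * (sinh ?\<alpha> * sinh ?\<beta>)"
      by (simp add: cosh_add cosh_diff algebra_simps)
    also have "2 * t - 1 = ?c / (?\<alpha> * ?\<beta>)"
    proof -
      have "2 * ((1 + y) / 2) - 1 = y" for y :: real by (simp add: field_simps)
      then show ?thesis unfolding t_def .
    qed
    finally show ?thesis by (simp add: mult_ac)
  qed
qed

text \<open>Averaging the previous bound over a centred \<open>Y\<close>: the factor \<open>sinh \<beta> / \<beta>\<close> can be replaced by
\<open>sinh \<beta> / \<beta> - 1\<close>, since the inner products with \<open>a\<close> sum to zero. The remaining term \<open>sinh \<beta> - \<beta>\<close> is of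
third order and combines with \<open>cosh \<beta>\<close> to \<open>exp \<beta> - \<beta>\<close>.\<close>

lemma sum_cosh_L2_set_add_le:
  fixes a :: "'t \<Rightarrow> real" and Y :: "'a \<Rightarrow> 't \<Rightarrow> real"
  assumes A: "finite A"
    and mean: "\<And>s. s \<in> T \<Longrightarrow> (\<Sum>x\<in>A. Y x s) = 0"
  shows "(\<Sum>x\<in>A. cosh (L2_set (\<lambda>s. a s + Y x s) T))
    \<le> cosh (L2_set a T) * (\<Sum>x\<in>A. exp (L2_set (Y x) T) - L2_set (Y x) T)"
proof -
  let ?\<alpha> = "L2_set a T" and ?\<beta> = "\<lambda>x. L2_set (Y x) T" and ?c = "\<lambda>x. \<Sum>s\<in>T. a s * Y x s"
  have c: "\<bar>?c x\<bar> \<le> ?\<alpha> * ?\<beta> x" for x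
    using sum_abs[of "\<lambda>s. a s * Y x s" T] L2_set_mult_ineq[of a "Y x" T] by (simp add: abs_mult)
  have shc: "y \<le> sinh y" if "y \<ge> 0" for y :: real
  proof -
    have "sinh 0 - 0 \<le> sinh y - y"
      by (rule DERIV_nonneg_imp_nondecreasing[OF that, of "\<lambda>y. sinh y - y"])
         (auto intro!: exI derivative_eq_intros cosh_real_ge_1)
    then show ?thesis by simp
  qed
  have c0: "(\<Sum>x\<in>A. ?c x) = 0"
    by (subst sum.swap) (simp add: mean flip: sum_distrib_left)
  have term_le: "?c x * (sinh ?\<alpha> / ?\<alpha>) * (sinh (?\<beta> x) / ?\<beta> x)
     \<le> ?c x * (sinh ?\<alpha> / ?\<alpha>) + sinh ?\<alpha> * (sinh (?\<beta> x) - ?\<beta> x)" for x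
  proof (cases "?\<alpha> = 0 \<or> ?\<beta> x = 0")
    case True
    then have "?c x = 0" using c[of x] by auto
    then show ?thesis using True by auto
  next
    case False
    then have pos: "?\<alpha> > 0" "?\<beta> x > 0"
      by (simp_all add: order_less_le)
    have "?c x * (sinh ?\<alpha> / ?\<alpha>) * (sinh (?\<beta> x) / ?\<beta> x - 1)
       \<le> (?\<alpha> * ?\<beta> x) * (sinh ?\<alpha> / ?\<alpha>) * (sinh (?\<beta> x) / ?\<beta> x - 1)"
      using c[of x] pos shc[of "?\<beta> x"] by (intro mult_right_mono) (auto simp: field_simps)
    also have "\<dots> = sinh ?\<alpha> * (sinh (?\<beta> x) - ?\<beta> x)"
      using pos by (simp add: field_simps)
    finally have "?c x * (sinh ?\<alpha> / ?\<alpha>) * (sinh (?\<beta> x) / ?\<beta> x - 1)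
      \<le> sinh ?\<alpha> * (sinh (?\<beta> x) - ?\<beta> x)" .
    moreover have "u * (w - 1) \<le> y \<Longrightarrow> u * w \<le> u + y" for u w y :: real
      by (simp add: algebra_simps)
    ultimately show ?thesis by blast
  qed
  have "(\<Sum>x\<in>A. cosh (L2_set (\<lambda>s. a s + Y x s) T))
     \<le> (\<Sum>x\<in>A. cosh ?\<alpha> * cosh (?\<beta> x) + (?c x * (sinh ?\<alpha> / ?\<alpha>) + sinh ?\<alpha> * (sinh (?\<beta> x) - ?\<beta> x)))"
    by (intro sum_mono order_trans[OF cosh_L2_set_add_le] add_left_mono term_le)
  also have "\<dots> = (\<Sum>x\<in>A. cosh ?\<alpha> * cosh (?\<beta> x) + sinh ?\<alpha> * (sinh (?\<beta> x) - ?\<beta> x))"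
    using c0 by (simp add: sum.distrib flip: sum_distrib_right sum_divide_distrib)
  also have "\<dots> \<le> (\<Sum>x\<in>A. cosh ?\<alpha> * cosh (?\<beta> x) + cosh ?\<alpha> * (sinh (?\<beta> x) - ?\<beta> x))"
    using shc by (intro sum_mono add_left_mono mult_right_mono) (auto simp: sinh_le_cosh_real)
  also have "\<dots> = cosh ?\<alpha> * (\<Sum>x\<in>A. exp (?\<beta> x) - ?\<beta> x)"
    by (simp add: sum_distrib_left add_diff_eq flip: distrib_left cosh_plus_sinh)
  finally show ?thesis .
qed

text \<open>The estimate \<open>(n + 2)! \<ge> 2 * 3\<^sup>n\<close> compares the tail of the exponential series with a geometric
series; this is the source of the \<open>B / 3\<close> in Bernstein's inequality.\<close>

lemma exp_minus_id_le:
  fixes b B :: real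
  assumes "0 \<le> b" "b \<le> B" "B < 3"
  shows "exp b - b \<le> 1 + b\<^sup>2 / (2 * (1 - B / 3))"
proof -
  have "exp b = (\<Sum>n. b ^ n / fact n)" and sm: "summable (\<lambda>n. b ^ n / fact n)"
    using exp_converges[of b] by (auto simp: sums_iff divide_inverse mult_ac)
  then have "exp b = (\<Sum>n. b ^ (n + 2) / fact (n + 2)) + (\<Sum>n<2. b ^ n / fact n)"
    by (simp only: suminf_split_initial_segment[OF sm, of 2])
  also have "(\<Sum>n<2. b ^ n / fact n) = 1 + b"
    by (simp add: numeral_2_eq_2)
  also have "(\<Sum>n. b ^ (n + 2) / fact (n + 2)) \<le> (\<Sum>n. b\<^sup>2 / 2 * (B / 3) ^ n)"
  proof (rule suminf_le)
    fix n
    have "2 * 3 ^ n \<le> (fact (n + 2) :: real)"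
    proof (induction n)
      case (Suc n)
      have "2 * 3 ^ Suc n = 3 * (2 * 3 ^ n :: real)" by simp
      also have "\<dots> \<le> real (n + 3) * fact (n + 2)"
        using Suc by (intro mult_mono) auto
      also have "\<dots> = fact (Suc n + 2)" by (simp add: add_ac)
      finally show ?case .
    qed simp
    moreover have "b ^ n \<le> B ^ n" using assms by (intro power_mono) auto
    ultimately have "b\<^sup>2 * b ^ n / fact (n + 2) \<le> b\<^sup>2 * B ^ n / (2 * 3 ^ n)"
      using assms by (intro frac_le mult_left_mono) auto
    then show "b ^ (n + 2) / fact (n + 2) \<le> b\<^sup>2 / 2 * (B / 3) ^ n"
      by (simp only: power_add power_divide mult_ac times_divide_eq_right times_divide_eq_left divide_divide_eq_left)
  next
    show "summable (\<lambda>n. b ^ (n + 2) / fact (n + 2))"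
      using sm by (rule summable_ignore_initial_segment)
    show "summable (\<lambda>n. b\<^sup>2 / 2 * (B / 3) ^ n)"
      using assms by (intro summable_mult summable_geometric) auto
  qed
  also have "\<dots> = b\<^sup>2 / 2 * (1 / (1 - B / 3))"
    using assms by (intro sums_unique[symmetric] sums_mult geometric_sums) auto
  finally show ?thesis by (simp add: field_simps)
qed

lemma sum_PiE_lessThan_Suc:
  fixes f :: "(nat \<Rightarrow> 'a) \<Rightarrow> real"
  shows "(\<Sum>w\<in>PiE {..<Suc J} (\<lambda>_. A). f w)
    = (\<Sum>w\<in>PiE {..<J} (\<lambda>_. A). \<Sum>x\<in>A. f (w(J := x)))"
proof -
  have "inj_on (\<lambda>(y, g). g(J := y)) (A \<times> PiE {..<J} (\<lambda>_. A))"
    by (rule inj_combinator) simp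
  then have "(\<Sum>w\<in>PiE {..<Suc J} (\<lambda>_. A). f w) = (\<Sum>(x, w)\<in>A \<times> PiE {..<J} (\<lambda>_. A). f (w(J := x)))"
    unfolding lessThan_Suc PiE_insert_eq by (subst sum.reindex) (auto simp: case_prod_beta)
  also have "\<dots> = (\<Sum>x\<in>A. \<Sum>w\<in>PiE {..<J} (\<lambda>_. A). f (w(J := x)))"
    by (simp add: sum.cartesian_product)
  also have "\<dots> = (\<Sum>w\<in>PiE {..<J} (\<lambda>_. A). \<Sum>x\<in>A. f (w(J := x)))"
    by (rule sum.swap)
  finally show ?thesis .
qed

text \<open>The sum over all sequences, divided by their number, is the expectation for independent uniform
samples; one further sample costs one further factor.\<close>

lemma sum_cosh_L2_set_sum_le:
  fixes Y :: "'a \<Rightarrow> 't \<Rightarrow> real"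
  assumes A: "finite A"
    and mean: "\<And>s. s \<in> T \<Longrightarrow> (\<Sum>x\<in>A. Y x s) = 0"
  shows "(\<Sum>w\<in>PiE {..<J} (\<lambda>_. A). cosh (L2_set (\<lambda>s. \<Sum>j<J. Y (w j) s) T))
    \<le> (\<Sum>x\<in>A. exp (L2_set (Y x) T) - L2_set (Y x) T) ^ J"
proof (induction J)
  case 0
  then show ?case by (simp add: L2_set_def)
next
  case (Suc J)
  let ?G = "\<Sum>x\<in>A. exp (L2_set (Y x) T) - L2_set (Y x) T"
  have G: "?G \<ge> 0"
  proof (rule sum_nonneg)
    fix x show "0 \<le> exp (L2_set (Y x) T) - L2_set (Y x) T"
      using exp_ge_add_one_self[of "L2_set (Y x) T"] by linarith
  qed
  have "(\<Sum>w\<in>PiE {..<Suc J} (\<lambda>_. A). cosh (L2_set (\<lambda>s. \<Sum>j<Suc J. Y (w j) s) T))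
    = (\<Sum>w\<in>PiE {..<J} (\<lambda>_. A). \<Sum>x\<in>A. cosh (L2_set (\<lambda>s. (\<Sum>j<J. Y (w j) s) + Y x s) T))"
    unfolding sum_PiE_lessThan_Suc by simp
  also have "\<dots> \<le> (\<Sum>w\<in>PiE {..<J} (\<lambda>_. A). cosh (L2_set (\<lambda>s. \<Sum>j<J. Y (w j) s) T) * ?G)"
    by (intro sum_mono sum_cosh_L2_set_add_le A mean)
  also have "\<dots> \<le> ?G ^ J * ?G"
    unfolding sum_distrib_right[symmetric] by (rule mult_right_mono[OF Suc G])
  finally show ?case by (simp add: mult.commute)
qed

text \<open>Bernstein's inequality for \<open>J\<close> independent uniform samples from \<open>A\<close> of a centred vector \<open>Y\<close> in a
Euclidean space with coordinates \<open>T\<close>, as a count of bad sequences. The bound does not depend on the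
dimension.\<close>

lemma vector_Bernstein_count:
  fixes Y :: "'a \<Rightarrow> 't \<Rightarrow> real"
  assumes A: "finite A" "A \<noteq> {}"
    and mean: "\<And>s. s \<in> T \<Longrightarrow> (\<Sum>x\<in>A. Y x s) = 0"
    and bound: "\<And>x. x \<in> A \<Longrightarrow> L2_set (Y x) T \<le> B"
    and var: "(\<Sum>x\<in>A. (L2_set (Y x) T)\<^sup>2) \<le> real (card A) * V"
    and pos: "0 < B" "0 < V" "0 < t" "0 < J"
  shows "real (card {w \<in> PiE {..<J} (\<lambda>_. A). t \<le> L2_set (\<lambda>s. \<Sum>j<J. Y (w j) s) T})
    \<le> 2 * exp (- t\<^sup>2 / (2 * (real J * V + B * t / 3))) * real (card A) ^ J"
proof -
  let ?n = "real (card A)"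
  let ?N = "\<lambda>w. L2_set (\<lambda>s. \<Sum>j<J. Y (w j) s) T"
  \<comment> \<open>The exponential parameter that balances the variance and the threshold.\<close>
  define D where "D = real J * V + B * t / 3"
  define l where "l = t / D"
  have JV: "0 < real J * V" using pos by simp
  have D: "0 < D" using pos JV unfolding D_def by (intro add_pos_pos) auto
  have l: "0 < l" using D pos by (simp add: l_def)
  have n: "0 < ?n" using A by (simp add: card_gt_0_iff)
  have lB: "1 - l * B / 3 = real J * V / D"
    using D by (simp add: l_def D_def field_simps)
  then have lB': "0 < 1 - l * B / 3" using JV D by simp
  have scale: "L2_set (\<lambda>s. l * f s) T = l * L2_set f T" for f
    using l by (simp add: L2_set_right_distrib)
  have "(\<Sum>w\<in>PiE {..<J} (\<lambda>_. A). cosh (l * ?N w))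
    = (\<Sum>w\<in>PiE {..<J} (\<lambda>_. A). cosh (L2_set (\<lambda>s. \<Sum>j<J. l * Y (w j) s) T))"
    by (simp add: scale flip: sum_distrib_left)
  also have "\<dots> \<le> (\<Sum>x\<in>A. exp (L2_set (\<lambda>s. l * Y x s) T) - L2_set (\<lambda>s. l * Y x s) T) ^ J"
    by (rule sum_cosh_L2_set_sum_le) (use A mean in \<open>auto simp flip: sum_distrib_left\<close>)
  also have "\<dots> \<le> (?n * exp (l\<^sup>2 * V / (2 * (1 - l * B / 3)))) ^ J"
  proof (rule power_mono)
    have "(\<Sum>x\<in>A. exp (L2_set (\<lambda>s. l * Y x s) T) - L2_set (\<lambda>s. l * Y x s) T)
       \<le> (\<Sum>x\<in>A. 1 + (l * L2_set (Y x) T)\<^sup>2 / (2 * (1 - l * B / 3)))"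
      unfolding scale using bound l lB' by (intro sum_mono exp_minus_id_le mult_left_mono) auto
    also have "\<dots> = ?n + l\<^sup>2 * (\<Sum>x\<in>A. (L2_set (Y x) T)\<^sup>2) / (2 * (1 - l * B / 3))"
      by (simp add: sum.distrib power_mult_distrib sum_distrib_left flip: sum_divide_distrib)
    also have "\<dots> \<le> ?n + l\<^sup>2 * (?n * V) / (2 * (1 - l * B / 3))"
      using var lB' by (intro add_left_mono divide_right_mono mult_left_mono) (simp_all add: mult.commute)
    also have "\<dots> = ?n * (1 + l\<^sup>2 * V / (2 * (1 - l * B / 3)))"
      by (simp add: algebra_simps)
    also have "\<dots> \<le> ?n * exp (l\<^sup>2 * V / (2 * (1 - l * B / 3)))"
      using n by (intro mult_left_mono exp_ge_add_one_self) auto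
    finally show "(\<Sum>x\<in>A. exp (L2_set (\<lambda>s. l * Y x s) T) - L2_set (\<lambda>s. l * Y x s) T)
      \<le> ?n * exp (l\<^sup>2 * V / (2 * (1 - l * B / 3)))" .
    show "0 \<le> (\<Sum>x\<in>A. exp (L2_set (\<lambda>s. l * Y x s) T) - L2_set (\<lambda>s. l * Y x s) T)"
    proof (rule sum_nonneg)
      fix x show "0 \<le> exp (L2_set (\<lambda>s. l * Y x s) T) - L2_set (\<lambda>s. l * Y x s) T"
        using exp_ge_add_one_self[of "L2_set (\<lambda>s. l * Y x s) T"] by linarith
    qed
  qed
  also have "\<dots> = ?n ^ J * exp (l * t / 2)"
  proof -
    have "real J * (l\<^sup>2 * V / (2 * (1 - l * B / 3))) = l * t / 2"
      unfolding lB using D JV pos by (simp add: l_def field_simps power2_eq_square)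
    then show ?thesis by (simp add: power_mult_distrib flip: exp_of_nat_mult)
  qed
  finally have upper: "(\<Sum>w\<in>PiE {..<J} (\<lambda>_. A). cosh (l * ?N w)) \<le> ?n ^ J * exp (l * t / 2)" .
  let ?bad = "{w \<in> PiE {..<J} (\<lambda>_. A). t \<le> ?N w}"
  have fin: "finite (PiE {..<J} (\<lambda>_. A))" using A by (intro finite_PiE) auto
  have "real (card ?bad) * (exp (l * t) / 2) = (\<Sum>w\<in>?bad. exp (l * t) / 2)" by simp
  also have "\<dots> \<le> (\<Sum>w\<in>?bad. cosh (l * ?N w))"
  proof (rule sum_mono)
    fix w assume "w \<in> ?bad"
    then have "exp (l * t) \<le> exp (l * ?N w)" using l by auto
    then show "exp (l * t) / 2 \<le> cosh (l * ?N w)" by (simp add: cosh_def add_increasing2)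
  qed
  also have "\<dots> \<le> (\<Sum>w\<in>PiE {..<J} (\<lambda>_. A). cosh (l * ?N w))"
    using fin by (intro sum_mono2) (auto simp: cosh_real_nonneg)
  also note upper
  finally have "real (card ?bad) \<le> 2 * (exp (l * t / 2) / exp (l * t)) * ?n ^ J"
    by (simp add: field_simps)
  also have "exp (l * t / 2) / exp (l * t) = exp (- t\<^sup>2 / (2 * D))"
    by (simp add: l_def power2_eq_square flip: exp_diff)
  finally show ?thesis by (simp add: D_def)
qed

section \<open>Uniform sampling of rows with small leverage\<close>

text \<open>The quadratic form \<open>z \<mapsto> (N / J) \<Sum>\<^sub>j ((W z) (v j))\<^sup>2 - \<parallel>W z\<parallel>\<^sup>2\<close> is, in orthonormal coordinates, given by the
average of the matrices \<open>Y (v j)\<close>, so the Frobenius norm of this average controls it for all \<open>z\<close> simultaneously.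
Here \<open>w r i\<close> is the entry of \<open>W\<close> in row \<open>i\<close> and column \<open>r\<close>, and \<open>b i\<close> is \<open>N\<close> times the leverage score
of row \<open>i\<close>.\<close>

lemma sampling_embedding_count:
  fixes w :: "nat \<Rightarrow> nat \<Rightarrow> real"
  assumes pos: "0 < N" "0 < J" "0 < R" "0 < \<epsilon>" "\<epsilon> < 1" "0 < B"
    and lev: "\<And>z i. i < N \<Longrightarrow>
      real N * (\<Sum>r<R. z r * w r i)\<^sup>2 \<le> B * (\<Sum>m<N. (\<Sum>r<R. z r * w r m)\<^sup>2)"
  shows "real (card {v \<in> PiE {..<J} (\<lambda>_. {..<N}). \<not> (\<forall>z.
      \<bar>real N / real J * (\<Sum>j<J. (\<Sum>r<R. z r * w r (v j))\<^sup>2) - (\<Sum>i<N. (\<Sum>r<R. z r * w r i)\<^sup>2)\<bar>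
        \<le> \<epsilon> * (\<Sum>i<N. (\<Sum>r<R. z r * w r i)\<^sup>2))})
    \<le> 2 * exp (- (3 * real J * \<epsilon>\<^sup>2 / (8 * B * real R))) * real N ^ J"
proof -
  obtain K q t c where K: "K \<le> R"
    and orth: "\<And>k l. k < K \<Longrightarrow> l < K \<Longrightarrow> (\<Sum>i<N. q k i * q l i) = (if k = l then 1 else 0)"
    and qt: "\<And>k i. k < K \<Longrightarrow> i \<in> {..<N} \<Longrightarrow> q k i = (\<Sum>r<R. t k r * w r i)"
    and wc: "\<And>z i. i \<in> {..<N} \<Longrightarrow> (\<Sum>r<R. z r * w r i) = (\<Sum>k<K. c z k * q k i)"
    using orthonormal_basis_exists[of "{..<N}" R w] by blast
  define b where "b i = real N * (\<Sum>k<K. (q k i)\<^sup>2)" for i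
  define Y where "Y i = (\<lambda>(k, l). real N * q k i * q l i - (if k = l then 1 else 0))" for i
  define T where "T = {..<K} \<times> {..<K}"
  have b0: "0 \<le> b i" for i by (simp add: b_def sum_nonneg)
  have bB: "b i \<le> B" if "i < N" for i
  proof -
    \<comment> \<open>The supremum that defines the leverage score is attained at the row itself.\<close>
    let ?h = "\<Sum>k<K. (q k i)\<^sup>2"
    have comb: "(\<Sum>r<R. (\<Sum>k<K. q k i * t k r) * w r m) = (\<Sum>k<K. q k i * q k m)" if "m < N" for m
    proof -
      have "(\<Sum>r<R. (\<Sum>k<K. q k i * t k r) * w r m) = (\<Sum>k<K. \<Sum>r<R. q k i * (t k r * w r m))"
        by (subst sum.swap) (simp add: sum_distrib_right mult.assoc)
      also have "\<dots> = (\<Sum>k<K. q k i * q k m)"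
        using qt[of _ m] that by (intro sum.cong refl) (simp add: sum_distrib_left)
      finally show ?thesis .
    qed
    have "real N * ?h\<^sup>2 \<le> B * (\<Sum>m<N. (\<Sum>k<K. q k i * q k m)\<^sup>2)"
      using lev[OF that, of "\<lambda>r. \<Sum>k<K. q k i * t k r"] comb that by (simp add: power2_eq_square)
    also have "(\<Sum>m<N. (\<Sum>k<K. q k i * q k m)\<^sup>2) = ?h"
      by (rule sum_squares_orthonormal[OF orth])
    finally have "b i * ?h \<le> B * ?h" by (simp add: b_def power2_eq_square mult.assoc)
    then show ?thesis
      using pos(6) sum_nonneg[of "{..<K}" "\<lambda>k. (q k i)\<^sup>2"]
      by (cases "?h = 0") (auto simp: b_def mult_le_cancel_right)
  qed
  have sum_b: "(\<Sum>i<N. b i) = real N * real K"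
  proof -
    have "(\<Sum>i<N. \<Sum>k<K. (q k i)\<^sup>2) = (\<Sum>k<K. \<Sum>i<N. q k i * q k i)"
      by (subst sum.swap) (simp add: power2_eq_square)
    also have "\<dots> = real K" by (simp add: orth)
    finally show ?thesis by (simp add: b_def flip: sum_distrib_left)
  qed
  \<comment> \<open>The mean leverage score is at most the largest one; if \<open>K > 0\<close>, this also yields \<open>B \<ge> 1\<close>.\<close>
  have KB: "real K \<le> B"
  proof -
    have "real N * real K \<le> real N * B"
      using sum_mono[of "{..<N}" b "\<lambda>_. B"] bB sum_b by simp
    then show ?thesis using pos by simp
  qed
  have sqT: "(L2_set f T)\<^sup>2 = (\<Sum>k<K. \<Sum>l<K. (f (k, l))\<^sup>2)" for f
    by (simp add: L2_set_def T_def sum_nonneg sum.cartesian_product)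
  have Y2: "(L2_set (Y i) T)\<^sup>2 = (b i)\<^sup>2 - 2 * b i + real K" for i
  proof -
    have "(L2_set (Y i) T)\<^sup>2 = (\<Sum>k<K. \<Sum>l<K. (real N * (q k i)\<^sup>2) * (real N * (q l i)\<^sup>2)
        - (if l = k then 2 * (real N * (q k i)\<^sup>2) - 1 else 0))"
      unfolding sqT Y_def by (intro sum.cong refl) (auto simp: power2_eq_square algebra_simps)
    also have "\<dots> = (\<Sum>k<K. real N * (q k i)\<^sup>2) * (\<Sum>l<K. real N * (q l i)\<^sup>2)
        - (2 * (\<Sum>k<K. real N * (q k i)\<^sup>2) - real K)"
      by (simp add: sum_subtractf sum_product) (simp add: sum_distrib_left)
    finally show ?thesis
      by (simp add: b_def power2_eq_square flip: sum_distrib_left)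
  qed
  have mean: "(\<Sum>i<N. Y i s) = 0" if "s \<in> T" for s
  proof (cases s)
    case (Pair k l)
    then show ?thesis
      using that orth[of k l] 
      by (simp add: Y_def T_def sum_subtractf mult.assoc flip: sum_distrib_left)
  qed
  have bound: "L2_set (Y i) T \<le> B" if "i < N" for i
  proof (rule power2_le_imp_le)
    have "(b i)\<^sup>2 - 2 * b i + real K \<le> B\<^sup>2"
    proof (cases "K = 0")
      case True
      then show ?thesis using bB[OF that] b0[of i] power_mono[of "b i" B 2] by (simp del: power_mono_iff)
    next
      case False
      then have B1: "1 \<le> B" using KB by linarith
      show ?thesis
      proof (cases "b i \<le> 2")
        case True
        then have "b i * (b i - 2) \<le> 0" using b0 by (simp add: mult_nonneg_nonpos)
        moreover have "B * 1 \<le> B * B" using B1 by (intro mult_left_mono) auto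
        ultimately show ?thesis using KB by (simp add: power2_eq_square algebra_simps)
      next
        case False
        then have "b i * (b i - 2) \<le> B * (B - 2)"
          using bB[OF that] by (intro mult_mono) auto
        then show ?thesis using KB B1 by (simp add: power2_eq_square algebra_simps)
      qed
    qed
    then show "(L2_set (Y i) T)\<^sup>2 \<le> B\<^sup>2" by (simp add: Y2)
  qed (use pos in simp)
  have var: "(\<Sum>i<N. (L2_set (Y i) T)\<^sup>2) \<le> real (card {..<N}) * (B * real R)"
  proof -
    have "(\<Sum>i<N. (L2_set (Y i) T)\<^sup>2) = (\<Sum>i<N. (b i)\<^sup>2) - 2 * (\<Sum>i<N. b i) + real N * real K"
      by (simp add: Y2 sum.distrib sum_subtractf sum_distrib_left)
    also have "\<dots> \<le> (\<Sum>i<N. (b i)\<^sup>2)" by (simp add: sum_b)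
    also have "\<dots> \<le> (\<Sum>i<N. B * b i)"
      using bB b0 by (intro sum_mono) (simp add: power2_eq_square mult_right_mono)
    also have "\<dots> = real N * (B * real K)" by (simp add: sum_b mult_ac flip: sum_distrib_left)
    also have "\<dots> \<le> real N * (B * real R)" using K pos by (intro mult_left_mono) auto
    finally show ?thesis by simp
  qed
  let ?G = "\<lambda>v. L2_set (\<lambda>s. \<Sum>j<J. Y (v j) s) T"
  let ?far = "{v \<in> PiE {..<J} (\<lambda>_. {..<N}). real J * \<epsilon> \<le> ?G v}"
  let ?ok = "\<lambda>v z. \<bar>real N / real J * (\<Sum>j<J. (\<Sum>r<R. z r * w r (v j))\<^sup>2)
      - (\<Sum>i<N. (\<Sum>r<R. z r * w r i)\<^sup>2)\<bar> \<le> \<epsilon> * (\<Sum>i<N. (\<Sum>r<R. z r * w r i)\<^sup>2)"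
  have ok: "?ok v z" if v: "v \<in> PiE {..<J} (\<lambda>_. {..<N})" and near: "?G v < real J * \<epsilon>" for v z
  proof -
    let ?c = "c z"
    have vN: "v j < N" if "j < J" for j using v that by (auto simp: PiE_iff)
    have n1: "(\<Sum>i<N. (\<Sum>r<R. z r * w r i)\<^sup>2) = (\<Sum>k<K. (?c k)\<^sup>2)"
      using sum_squares_orthonormal[OF orth, of K ?c] by (simp add: wc)
    have n2: "(\<Sum>j<J. (\<Sum>r<R. z r * w r (v j))\<^sup>2) = (\<Sum>j<J. (\<Sum>k<K. ?c k * q k (v j))\<^sup>2)"
      by (intro sum.cong refl) (simp add: wc vN)
    have each: "(\<Sum>s\<in>T. ?c (fst s) * ?c (snd s) * Y i s)
       = real N * (\<Sum>k<K. ?c k * q k i)\<^sup>2 - (\<Sum>k<K. (?c k)\<^sup>2)" for i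
    proof -
      have "(\<Sum>s\<in>T. ?c (fst s) * ?c (snd s) * Y i s)
         = (\<Sum>k<K. \<Sum>l<K. real N * (?c k * q k i * (?c l * q l i)) - (if l = k then (?c k)\<^sup>2 else 0))"
        unfolding T_def sum.cartesian_product Y_def
        by (intro sum.cong refl) (auto simp: power2_eq_square algebra_simps)
      also have "\<dots> = real N * (\<Sum>k<K. ?c k * q k i)\<^sup>2 - (\<Sum>k<K. (?c k)\<^sup>2)"
        by (simp add: sum_subtractf power2_eq_square[of "sum _ _"] sum_product)
           (simp add: sum_distrib_left)
      finally show ?thesis .
    qed
    have "(\<Sum>s\<in>T. ?c (fst s) * ?c (snd s) * (\<Sum>j<J. Y (v j) s))
        = (\<Sum>j<J. \<Sum>s\<in>T. ?c (fst s) * ?c (snd s) * Y (v j) s)"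
      by (subst sum.swap) (simp add: sum_distrib_left)
    also have "\<dots> = real N * (\<Sum>j<J. (\<Sum>k<K. ?c k * q k (v j))\<^sup>2) - real J * (\<Sum>k<K. (?c k)\<^sup>2)"
      by (simp add: each sum_subtractf sum_distrib_left)
    finally have eq: "(\<Sum>s\<in>T. ?c (fst s) * ?c (snd s) * (\<Sum>j<J. Y (v j) s))
      = real J * (real N / real J * (\<Sum>j<J. (\<Sum>k<K. ?c k * q k (v j))\<^sup>2) - (\<Sum>k<K. (?c k)\<^sup>2))"
      using pos by (simp add: right_diff_distrib)
    have nc: "L2_set (\<lambda>s. ?c (fst s) * ?c (snd s)) T = (\<Sum>k<K. (?c k)\<^sup>2)"
    proof -
      have "(L2_set (\<lambda>s. ?c (fst s) * ?c (snd s)) T)\<^sup>2 = (\<Sum>k<K. (?c k)\<^sup>2)\<^sup>2"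
        by (simp add: sqT power2_eq_square[of "sum _ _"] sum_product power_mult_distrib)
      then show ?thesis by (subst (asm) power2_eq_iff_nonneg) (simp_all add: sum_nonneg)
    qed
    have "\<bar>\<Sum>s\<in>T. ?c (fst s) * ?c (snd s) * (\<Sum>j<J. Y (v j) s)\<bar> \<le> (\<Sum>k<K. (?c k)\<^sup>2) * ?G v"
      unfolding nc[symmetric]
      by (rule order_trans[OF sum_abs L2_set_mult_ineq[unfolded abs_mult[symmetric]]])
    also have "\<dots> \<le> (\<Sum>k<K. (?c k)\<^sup>2) * (real J * \<epsilon>)"
      using near by (intro mult_left_mono) (auto simp: sum_nonneg)
    finally have "real J * \<bar>real N / real J * (\<Sum>j<J. (\<Sum>k<K. ?c k * q k (v j))\<^sup>2) - (\<Sum>k<K. (?c k)\<^sup>2)\<bar>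
       \<le> real J * (\<epsilon> * (\<Sum>k<K. (?c k)\<^sup>2))"
      unfolding eq by (simp only: abs_mult abs_of_nat mult_ac)
    then show ?thesis unfolding n1 n2 using pos by (subst (asm) mult_le_cancel_left_pos) auto
  qed
  have "{v \<in> PiE {..<J} (\<lambda>_. {..<N}). \<not> (\<forall>z. ?ok v z)} \<subseteq> ?far"
  proof (rule subsetI)
    fix v assume "v \<in> {v \<in> PiE {..<J} (\<lambda>_. {..<N}). \<not> (\<forall>z. ?ok v z)}"
    then obtain z where v: "v \<in> PiE {..<J} (\<lambda>_. {..<N})" and z: "\<not> ?ok v z" by blast
    have "\<not> ?G v < real J * \<epsilon>" using ok[OF v] z by blast
    then show "v \<in> ?far" using v by simp
  qed
  moreover have "finite ?far"
    by (rule finite_subset[of _ "PiE {..<J} (\<lambda>_. {..<N})"]) (auto intro!: finite_PiE)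
  ultimately have "real (card {v \<in> PiE {..<J} (\<lambda>_. {..<N}). \<not> (\<forall>z. ?ok v z)}) \<le> real (card ?far)"
    by (intro of_nat_mono card_mono)
  also have "\<dots> \<le> 2 * exp (- (real J * \<epsilon>)\<^sup>2 / (2 * (real J * (B * real R) + B * (real J * \<epsilon>) / 3)))
      * real (card {..<N}) ^ J"
    using pos mean bound var by (intro vector_Bernstein_count) auto
  also have "\<dots> \<le> 2 * exp (- (3 * real J * \<epsilon>\<^sup>2 / (8 * B * real R))) * real N ^ J"
  proof -
    have "B * (real J * \<epsilon>) / 3 \<le> B * (real J * real R) / 3"
      using pos by (intro divide_right_mono mult_left_mono) auto
    then have le: "2 * (real J * (B * real R) + B * (real J * \<epsilon>) / 3) \<le> 8 / 3 * (real J * B * real R)"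
      by (simp add: field_simps)
    have "3 * real J * \<epsilon>\<^sup>2 / (8 * B * real R) = (real J * \<epsilon>)\<^sup>2 / (8 / 3 * (real J * B * real R))"
      using pos by (simp add: field_simps power2_eq_square)
    also have "\<dots> \<le> (real J * \<epsilon>)\<^sup>2 / (2 * (real J * (B * real R) + B * (real J * \<epsilon>) / 3))"
      using pos le by (intro divide_left_mono) (auto intro!: mult_pos_pos add_pos_pos)
    finally show ?thesis
      by (intro mult_mono) (simp_all del: of_nat_mult)
  qed
  finally show ?thesis .
qed

section \<open>Kronecker products\<close>

lemma sum_div_mod:
  fixes f :: "nat \<Rightarrow> nat \<Rightarrow> real"
  shows "(\<Sum>i<m * n. f (i div n) (i mod n)) = (\<Sum>a<m. \<Sum>b<n. f a b)"
proof -
  have "(\<Sum>i\<in>{a * n..<a * n + n}. f (i div n) (i mod n)) = (\<Sum>b<n. f a b)" for a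
    by (simp add: sum.atLeastLessThan_shift_0[of _ "a * n"] atLeast0LessThan)
  then show ?thesis
    by (simp flip: sum.nat_group)
qed

lemma kron_vec_index:
  assumes "a \<in> carrier_vec m" "b \<in> carrier_vec n" "i < m * n"
  shows "kron_vec a b $ i = a $ (i div n) * b $ (i mod n)"
  using assms by (simp add: kron_vec_def)

lemma scalar_prod_lessThan: "v \<in> carrier_vec n \<Longrightarrow> u \<bullet> v = (\<Sum>i<n. u $ i * v $ i)" for v :: "real Matrix.vec"
  by (auto simp: scalar_prod_def atLeast0LessThan)

lemma kron_vec_scalar_prod:
  assumes "a \<in> carrier_vec m" "b \<in> carrier_vec n" "a' \<in> carrier_vec m" "b' \<in> carrier_vec n"
  shows "kron_vec a b \<bullet> kron_vec a' b' = (a \<bullet> a') * (b \<bullet> b')"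
proof -
  have "kron_vec a' b' \<in> carrier_vec (m * n)" using assms by (auto simp: kron_vec_def)
  then have "kron_vec a b \<bullet> kron_vec a' b'
      = (\<Sum>i<m * n. (a $ (i div n) * a' $ (i div n)) * (b $ (i mod n) * b' $ (i mod n)))"
    using assms by (simp add: scalar_prod_lessThan kron_vec_index mult_ac)
  also have "\<dots> = (\<Sum>i<m. \<Sum>j<n. (a $ i * a' $ i) * (b $ j * b' $ j))"
    by (rule sum_div_mod)
  also have "\<dots> = (a \<bullet> a') * (b \<bullet> b')"
    using assms by (simp add: scalar_prod_lessThan sum_product)
  finally show ?thesis .
qed

lemma kron_vecs_scalar_prod:
  assumes "\<And>p. p < P \<Longrightarrow> a p \<in> carrier_vec (n p)" "\<And>p. p < P \<Longrightarrow> b p \<in> carrier_vec (n p)"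
  shows "kron_vecs a P \<bullet> kron_vecs b P = (\<Prod>p<P. a p \<bullet> b p)"
  using assms
proof (induction P)
  case 0
  then show ?case by (simp add: scalar_prod_def)
next
  case (Suc P)
  then have "kron_vecs a P \<in> carrier_vec (\<Prod>p<P. n p)" "kron_vecs b P \<in> carrier_vec (\<Prod>p<P. n p)"
    by (intro kron_vecs_carrier; simp)+
  with Suc show ?case
    by (simp add: kron_vec_scalar_prod[of _ "\<Prod>p<P. n p" _ "n P"])
qed

lemma kron_mat_mult_kron_vec:
  assumes "A \<in> carrier_mat m m'" "B \<in> carrier_mat n n'" "a \<in> carrier_vec m'" "b \<in> carrier_vec n'"
  shows "kron_mat A B *\<^sub>v kron_vec a b = kron_vec (A *\<^sub>v a) (B *\<^sub>v b)"
proof (rule eq_vecI)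
  have ab: "kron_vec a b \<in> carrier_vec (m' * n')" using assms by (auto simp: kron_vec_def)
  show "dim_vec (kron_mat A B *\<^sub>v kron_vec a b) = dim_vec (kron_vec (A *\<^sub>v a) (B *\<^sub>v b))"
    by (simp add: kron_mat_def kron_vec_def)
  fix i assume "i < dim_vec (kron_vec (A *\<^sub>v a) (B *\<^sub>v b))"
  then have i: "i < m * n" using assms by (simp add: kron_vec_def)
  then have "n > 0" by (cases n) auto
  then have i': "i div n < m" "i mod n < n"
    using i by (auto simp: less_mult_imp_div_less)
  have "(kron_mat A B *\<^sub>v kron_vec a b) $ i = (\<Sum>j<m' * n'. (A $$ (i div n, j div n') * a $ (j div n'))
      * (B $$ (i mod n, j mod n') * b $ (j mod n')))"
    using assms ab i by (simp add: scalar_prod_lessThan kron_vec_index kron_mat_def mult_ac)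
  also have "\<dots> = (\<Sum>j<m'. \<Sum>k<n'. (A $$ (i div n, j) * a $ j) * (B $$ (i mod n, k) * b $ k))"
    by (rule sum_div_mod)
  also have "\<dots> = (A *\<^sub>v a) $ (i div n) * (B *\<^sub>v b) $ (i mod n)"
    using assms i' by (simp add: scalar_prod_lessThan sum_product)
  also have "\<dots> = kron_vec (A *\<^sub>v a) (B *\<^sub>v b) $ i"
    using assms i by (simp add: kron_vec_def)
  finally show "(kron_mat A B *\<^sub>v kron_vec a b) $ i = kron_vec (A *\<^sub>v a) (B *\<^sub>v b) $ i" .
qed

lemma kron_mats_mult_kron_vecs:
  assumes "\<And>p. p < P \<Longrightarrow> A p \<in> carrier_mat (m p) (n p)" "\<And>p. p < P \<Longrightarrow> a p \<in> carrier_vec (n p)"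
  shows "kron_mats A P *\<^sub>v kron_vecs a P = kron_vecs (\<lambda>p. A p *\<^sub>v a p) P"
  using assms
proof (induction P)
  case (Suc P)
  then have "kron_mats A P \<in> carrier_mat (\<Prod>p<P. m p) (\<Prod>p<P. n p)"
    "kron_vecs a P \<in> carrier_vec (\<Prod>p<P. n p)"
    by (intro kron_mats_carrier kron_vecs_carrier; simp)+
  with Suc show ?case
    by (simp add: kron_mat_mult_kron_vec[of _ "\<Prod>p<P. m p" "\<Prod>p<P. n p" _ "m P" "n P"])
qed simp

section \<open>Leverage bounds and Kronecker products\<close>

text \<open>The least such \<open>c\<close> is the largest leverage score, also called the coherence, of the matrix with
columns \<open>y 0, \<dots>, y (R - 1)\<close>. The formulation by combinations of the columns avoids a choice of basis.\<close>

definition leverage_le :: "nat \<Rightarrow> nat \<Rightarrow> (nat \<Rightarrow> real Matrix.vec) \<Rightarrow> real \<Rightarrow> bool" where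
  "leverage_le R n y c \<longleftrightarrow>
    (\<forall>z. \<forall>i<n. (\<Sum>r<R. z r * y r $ i)\<^sup>2 \<le> c * (\<Sum>m<n. (\<Sum>r<R. z r * y r $ m)\<^sup>2))"

text \<open>Fix the row \<open>(i, j)\<close>. Evaluating the second factors at \<open>j\<close> turns a combination of the Kronecker
vectors into a combination of the \<open>a r\<close>, to which the first bound applies; each squared entry of the
result is the square of an evaluation at \<open>j\<close> of a combination of the \<open>b r\<close>, to which the second bound
applies.\<close>

lemma leverage_le_kron_vec:
  assumes a: "\<And>r. r < R \<Longrightarrow> a r \<in> carrier_vec m" and b: "\<And>r. r < R \<Longrightarrow> b r \<in> carrier_vec n"
    and la: "leverage_le R m a c" and lb: "leverage_le R n b d" and c: "0 \<le> c"
  shows "leverage_le R (m * n) (\<lambda>r. kron_vec (a r) (b r)) (c * d)"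
  unfolding leverage_le_def
proof (intro allI impI)
  fix z :: "nat \<Rightarrow> real" and i assume i: "i < m * n"
  then have "n > 0" by (cases n) auto
  then have i': "i div n < m" "i mod n < n"
    using i by (auto simp: less_mult_imp_div_less)
  have "(\<Sum>r<R. z r * kron_vec (a r) (b r) $ i)\<^sup>2 = (\<Sum>r<R. (z r * b r $ (i mod n)) * a r $ (i div n))\<^sup>2"
    using i by (simp add: kron_vec_index[OF a b] mult_ac)
  also have "\<dots> \<le> c * (\<Sum>k<m. (\<Sum>r<R. (z r * b r $ (i mod n)) * a r $ k)\<^sup>2)"
    by (rule la[unfolded leverage_le_def, rule_format, OF i'(1)])
  also have "\<dots> = c * (\<Sum>k<m. (\<Sum>r<R. (z r * a r $ k) * b r $ (i mod n))\<^sup>2)"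
    by (simp add: mult_ac)
  also have "\<dots> \<le> c * (\<Sum>k<m. d * (\<Sum>l<n. (\<Sum>r<R. (z r * a r $ k) * b r $ l)\<^sup>2))"
    by (intro mult_left_mono sum_mono c lb[unfolded leverage_le_def, rule_format, OF i'(2)])
  also have "\<dots> = c * d * (\<Sum>k<m. \<Sum>l<n. (\<Sum>r<R. z r * (a r $ k * b r $ l))\<^sup>2)"
    by (simp add: sum_distrib_left mult_ac)
  also have "\<dots> = c * d * (\<Sum>k<m * n. (\<Sum>r<R. z r * (a r $ (k div n) * b r $ (k mod n)))\<^sup>2)"
    by (simp only: sum_div_mod[where f = "\<lambda>k l. (\<Sum>r<R. z r * (a r $ k * b r $ l))\<^sup>2"])
  also have "\<dots> = c * d * (\<Sum>k<m * n. (\<Sum>r<R. z r * kron_vec (a r) (b r) $ k)\<^sup>2)"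
    by (simp add: kron_vec_index[OF a b])
  finally show "(\<Sum>r<R. z r * kron_vec (a r) (b r) $ i)\<^sup>2
    \<le> c * d * (\<Sum>k<m * n. (\<Sum>r<R. z r * kron_vec (a r) (b r) $ k)\<^sup>2)" .
qed

lemma leverage_le_kron_vecs:
  assumes "\<And>r p. r < R \<Longrightarrow> p < P \<Longrightarrow> y r p \<in> carrier_vec (n p)"
    and "\<And>p. p < P \<Longrightarrow> leverage_le R (n p) (\<lambda>r. y r p) (c p)" and "\<And>p. p < P \<Longrightarrow> 0 \<le> c p"
  shows "leverage_le R (\<Prod>p<P. n p) (\<lambda>r. kron_vecs (y r) P) (\<Prod>p<P. c p)"
  using assms
proof (induction P)
  case 0
  show ?case by (simp add: leverage_le_def)
next
  case (Suc P)
  show ?case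
    unfolding prod.lessThan_Suc kron_vecs.simps
    using Suc by (intro leverage_le_kron_vec kron_vecs_carrier prod_nonneg) auto
qed

section \<open>The randomized Hadamard transform\<close>

lemma hadamard_Suc_index:
  assumes "i < 2 ^ Suc k" "j < 2 ^ Suc k"
  shows "hadamard (Suc k) $$ (i, j) = (if 2 ^ k \<le> i \<and> 2 ^ k \<le> j then -1 else 1) / sqrt 2
    * hadamard k $$ (i mod 2 ^ k, j mod 2 ^ k)"
proof -
  have m: "l mod 2 ^ k = (if l < 2 ^ k then l else l - 2 ^ k)" if "l < 2 ^ Suc k" for l :: nat
    using that by (simp add: mod_if)
  have "dim_row (hadamard k) = 2 ^ k" "dim_col (hadamard k) = 2 ^ k"
    using hadamard_carrier[of k] by auto
  then show ?thesis
    using assms by (cases "i < 2 ^ k"; cases "j < 2 ^ k") (simp_all add: m[OF assms(1)] m[OF assms(2)])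
qed

lemma hadamard_entry_square:
  "i < 2 ^ k \<Longrightarrow> j < 2 ^ k \<Longrightarrow> (hadamard k $$ (i, j))\<^sup>2 = 1 / 2 ^ k"
proof (induction k arbitrary: i j)
  case (Suc k)
  then show ?case
    by (simp only: hadamard_Suc_index power_mult_distrib) (auto simp: power_divide)
qed simp

lemma hadamard_columns_orthonormal:
  "a < 2 ^ k \<Longrightarrow> b < 2 ^ k \<Longrightarrow>
    (\<Sum>i<2 ^ k. hadamard k $$ (i, a) * hadamard k $$ (i, b)) = (if a = b then 1 else 0)"
proof (induction k arbitrary: a b)
  case (Suc k)
  let ?n = "2 ^ k :: nat" and ?H = "hadamard (Suc k)" and ?h = "hadamard k"
  let ?s = "\<lambda>j::nat. if ?n \<le> j then -1 else 1 :: real"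
  have "(\<Sum>i<m + m. f i) = (\<Sum>i<m. f i) + (\<Sum>i<m. f (m + i))" for m and f :: "nat \<Rightarrow> real"
    using sum.nat_group[of f m 2]
    by (simp add: numeral_2_eq_2 sum.atLeastLessThan_shift_0[of _ m] atLeast0LessThan)
  from this[of _ ?n] have split: "(\<Sum>i<2 ^ Suc k. f i) = (\<Sum>i<?n. f i) + (\<Sum>i<?n. f (?n + i))"
    for f :: "nat \<Rightarrow> real"
    by (simp add: mult_2)
  \<comment> \<open>The two halves of a column: the lower one has the opposite sign in the right half of the matrix.\<close>
  have top: "?H $$ (i, j) = ?h $$ (i, j mod ?n) / sqrt 2" if "i < ?n" "j < 2 ^ Suc k" for i j
    using that by (subst hadamard_Suc_index) auto
  have bot: "?H $$ (?n + i, j) = ?s j * ?h $$ (i, j mod ?n) / sqrt 2" if "i < ?n" "j < 2 ^ Suc k" for i j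
    using that by (subst hadamard_Suc_index) auto
  have IH: "(\<Sum>i<?n. ?h $$ (i, a mod ?n) * ?h $$ (i, b mod ?n)) = (if a mod ?n = b mod ?n then 1 else 0)"
    by (rule Suc.IH) auto
  have "(\<Sum>i<2 ^ Suc k. ?H $$ (i, a) * ?H $$ (i, b))
    = (\<Sum>i<?n. ?h $$ (i, a mod ?n) * ?h $$ (i, b mod ?n)) * ((1 + ?s a * ?s b) / 2)"
    unfolding split sum.distrib[symmetric] sum_distrib_right
  proof (rule sum.cong[OF refl])
    fix i assume "i \<in> {..<?n}"
    then have i: "i < ?n" by simp
    have "x / sqrt 2 * (y / sqrt 2) + (u * x / sqrt 2) * (w * y / sqrt 2) = x * y * ((1 + u * w) / 2)"
      for x y u w :: real
      by (simp add: field_simps)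
    then show "?H $$ (i, a) * ?H $$ (i, b) + ?H $$ (?n + i, a) * ?H $$ (?n + i, b)
      = ?h $$ (i, a mod ?n) * ?h $$ (i, b mod ?n) * ((1 + ?s a * ?s b) / 2)"
      by (simp only: top[OF i Suc.prems(1)] top[OF i Suc.prems(2)] bot[OF i Suc.prems(1)] bot[OF i Suc.prems(2)])
  qed
  also have "\<dots> = (if a mod ?n = b mod ?n then 1 else 0) * ((1 + ?s a * ?s b) / 2)"
    by (simp only: IH)
  also have "\<dots> = (if a = b then 1 else 0)"
    using Suc.prems by (auto simp: mod_if split: if_splits)
  finally show ?case .
qed simp

definition rand_hadamard :: "nat \<Rightarrow> (nat \<Rightarrow> real) \<Rightarrow> real mat" where
  "rand_hadamard k s = hadamard k * mat_diag (2 ^ k) s"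

lemma rand_hadamard_carrier [simp]: "rand_hadamard k s \<in> carrier_mat (2 ^ k) (2 ^ k)"
  unfolding rand_hadamard_def by (rule mult_carrier_mat[OF hadamard_carrier mat_diag_dim])

lemma rand_hadamard_mult_index:
  assumes "y \<in> carrier_vec (2 ^ k)" "i < 2 ^ k"
  shows "(rand_hadamard k s *\<^sub>v y) $ i = (\<Sum>j<2 ^ k. hadamard k $$ (i, j) * (s j * y $ j))"
proof -
  have "rand_hadamard k s $$ (i, j) = hadamard k $$ (i, j) * s j" if "j < 2 ^ k" for j
    unfolding rand_hadamard_def mat_diag_mult_right[OF hadamard_carrier] using assms that by simp
  moreover have "dim_row (rand_hadamard k s) = 2 ^ k" "dim_col (rand_hadamard k s) = 2 ^ k"
    using rand_hadamard_carrier[of k s] by (auto simp del: rand_hadamard_carrier)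
  ultimately show ?thesis
    using assms by (simp add: scalar_prod_lessThan mult.assoc)
qed

lemma rand_hadamard_scalar_prod:
  assumes s: "\<And>j. j < 2 ^ k \<Longrightarrow> s j \<in> {-1, 1}"
    and xy: "x \<in> carrier_vec (2 ^ k)" "y \<in> carrier_vec (2 ^ k)"
  shows "(rand_hadamard k s *\<^sub>v x) \<bullet> (rand_hadamard k s *\<^sub>v y) = x \<bullet> y"
proof -
  let ?n = "2 ^ k :: nat" and ?h = "\<lambda>i j. hadamard k $$ (i, j)"
  have c: "rand_hadamard k s *\<^sub>v y \<in> carrier_vec ?n"
    by (rule mult_mat_vec_carrier[OF rand_hadamard_carrier xy(2)])
  have "(rand_hadamard k s *\<^sub>v x) \<bullet> (rand_hadamard k s *\<^sub>v y)
     = (\<Sum>i<?n. \<Sum>a<?n. \<Sum>b<?n. (s a * x $ a) * (s b * y $ b) * (?h i a * ?h i b))"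
    unfolding scalar_prod_lessThan[OF c]
    by (intro sum.cong refl) (simp add: rand_hadamard_mult_index xy sum_product mult_ac)
  also have "\<dots> = (\<Sum>a<?n. \<Sum>b<?n. \<Sum>i<?n. (s a * x $ a) * (s b * y $ b) * (?h i a * ?h i b))"
    by (subst sum.swap, rule sum.cong[OF refl], rule sum.swap)
  also have "\<dots> = (\<Sum>a<?n. \<Sum>b<?n. if b = a then (s a * s a) * (x $ a * y $ a) else 0)"
    by (intro sum.cong refl) (auto simp: hadamard_columns_orthonormal simp flip: sum_distrib_left)
  also have "\<dots> = (\<Sum>a<?n. (s a * s a) * (x $ a * y $ a))"
    by simp
  also have "\<dots> = (\<Sum>a<?n. x $ a * y $ a)"
  proof (intro sum.cong refl)
    fix a assume "a \<in> {..<?n}"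
    then have "s a * s a = 1" using s[of a] by auto
    then show "(s a * s a) * (x $ a * y $ a) = x $ a * y $ a" by simp
  qed
  finally show ?thesis by (simp only: scalar_prod_lessThan[OF xy(2)])
qed

lemma (in prob_space) rademacher_tail:
  fixes \<xi> :: "'b \<Rightarrow> 'a \<Rightarrow> real" and a :: "'b \<Rightarrow> real"
  assumes A: "finite A" and indep: "indep_vars (\<lambda>_. count_space {-1, 1}) \<xi> A"
    and distr: "\<And>i. i \<in> A \<Longrightarrow> distr M (count_space {-1, 1}) (\<xi> i) = uniform_count_measure {-1, 1}"
    and pos: "0 < (\<Sum>i\<in>A. (a i)\<^sup>2)" and t: "0 \<le> t"
  shows "{\<omega> \<in> space M. t \<le> \<bar>\<Sum>i\<in>A. a i * \<xi> i \<omega>\<bar>} \<in> events"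
    and "prob {\<omega> \<in> space M. t \<le> \<bar>\<Sum>i\<in>A. a i * \<xi> i \<omega>\<bar>} \<le> 2 * exp (- t\<^sup>2 / (2 * (\<Sum>i\<in>A. (a i)\<^sup>2)))"
proof -
  have m: "\<xi> i \<in> measurable M (count_space {-1, 1})" if "i \<in> A" for i
    using indep that by (auto simp: indep_vars_def)
  have val: "\<xi> i \<omega> \<in> {-1, 1}" if "i \<in> A" "\<omega> \<in> space M" for i \<omega>
    using measurable_space[OF m] that by (metis space_count_space)
  have ind: "indep_vars (\<lambda>_. borel) (\<lambda>i \<omega>. a i * \<xi> i \<omega>) A"
    by (rule indep_vars_compose2[OF indep, where Y = "\<lambda>i y. a i * y"]) simp
  have E: "expectation (\<lambda>\<omega>. a i * \<xi> i \<omega>) = 0" if "i \<in> A" for i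
  proof -
    have "expectation (\<lambda>\<omega>. a i * \<xi> i \<omega>) = integral\<^sup>L (distr M (count_space {-1, 1}) (\<xi> i)) (\<lambda>y. a i * y)"
      by (rule integral_distr[symmetric, OF m[OF that]]) simp
    also have "\<dots> = 0"
      unfolding distr[OF that] by (subst integral_uniform_count_measure) auto
    finally show ?thesis .
  qed
  interpret H: Hoeffding_ineq M A "\<lambda>i \<omega>. a i * \<xi> i \<omega>" "\<lambda>i. - \<bar>a i\<bar>" "\<lambda>i. \<bar>a i\<bar>"
    "\<Sum>i\<in>A. expectation (\<lambda>\<omega>. a i * \<xi> i \<omega>)"
  proof unfold_locales
    fix i assume "i \<in> A"
    then show "AE x in M. a i * \<xi> i x \<in> {- \<bar>a i\<bar>..\<bar>a i\<bar>}"
      using val[of i] by (intro AE_I2) fastforce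
  qed (use A ind in auto)
  have E0: "(\<Sum>i\<in>A. expectation (\<lambda>\<omega>. a i * \<xi> i \<omega>)) = 0"
    by (intro sum.neutral ballI E)
  have "(\<Sum>i\<in>A. (\<bar>a i\<bar> - - \<bar>a i\<bar>)\<^sup>2) = 4 * (\<Sum>i\<in>A. (a i)\<^sup>2)"
    by (simp add: power_mult_distrib sum_distrib_left)
  then show "prob {\<omega> \<in> space M. t \<le> \<bar>\<Sum>i\<in>A. a i * \<xi> i \<omega>\<bar>} \<le> 2 * exp (- t\<^sup>2 / (2 * (\<Sum>i\<in>A. (a i)\<^sup>2)))"
    using H.Hoeffding_ineq_abs_ge[OF t] pos unfolding E0 by simp
  have [measurable]: "(\<lambda>\<omega>. a i * \<xi> i \<omega>) \<in> borel_measurable M" if "i \<in> A" for i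
    using ind that by (auto simp: indep_vars_def)
  show "{\<omega> \<in> space M. t \<le> \<bar>\<Sum>i\<in>A. a i * \<xi> i \<omega>\<bar>} \<in> events"
    by measurable
qed

text \<open>By linearity, the entries \<open>G i l\<close> of the transformed orthonormal basis determine all transformed
vectors. Row \<open>i\<close> has at most \<open>R\<close> of them, so a bound \<open>\<tau>\<close> on each gives the leverage bound \<open>R \<tau>\<^sup>2\<close>. The
coefficients of \<open>G i l\<close> have squares that sum to \<open>1 / n\<close> because all entries of the Hadamard matrix have
the same modulus; this is how the transform spreads mass over all rows.\<close>

lemma (in prob_space) rand_hadamard_leverage:
  fixes \<xi> :: "nat \<Rightarrow> 'a \<Rightarrow> real" and b :: "nat \<Rightarrow> real Matrix.vec"
  assumes n_def: "n = 2 ^ k" and indep: "indep_vars (\<lambda>_. count_space {-1, 1}) \<xi> {..<n}"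
    and distr: "\<And>i. i < n \<Longrightarrow> distr M (count_space {-1, 1}) (\<xi> i) = uniform_count_measure {-1, 1}"
    and b: "\<And>r. r < R \<Longrightarrow> b r \<in> carrier_vec n"
    and R: "0 < R" and \<eta>: "0 < \<eta>" "\<eta> \<le> 1"
  shows "prob {\<omega> \<in> space M. \<not> leverage_le R n (\<lambda>r. rand_hadamard k (\<lambda>i. \<xi> i \<omega>) *\<^sub>v b r)
    (2 * real R * ln (2 * real n * real R / \<eta>) / real n)} \<le> \<eta>"
proof -
  let ?h = "\<lambda>i j. hadamard k $$ (i, j)"
  obtain K q t c where K: "K \<le> R"
    and orth: "\<And>k l. k < K \<Longrightarrow> l < K \<Longrightarrow> (\<Sum>i<n. q k i * q l i) = (if k = l then 1 else 0)"
    and "\<And>k i. k < K \<Longrightarrow> i \<in> {..<n} \<Longrightarrow> q k i = (\<Sum>r<R. t k r * b r $ i)"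
    and bc: "\<And>z i. i \<in> {..<n} \<Longrightarrow> (\<Sum>r<R. z r * b r $ i) = (\<Sum>k<K. c z k * q k i)"
    using orthonormal_basis_exists[of "{..<n}" R "\<lambda>r i. b r $ i"] by blast
  have n: "0 < n" by (simp add: n_def)
  \<comment> \<open>Chosen such that the tail bound \<open>2 exp (- \<tau>\<^sup>2 n / 2)\<close> equals \<open>\<eta> / (n R)\<close>.\<close>
  define \<tau> where "\<tau> = sqrt (2 * ln (2 * real n * real R / \<eta>) / real n)"
  have "\<eta> \<le> 2 * real n * real R"
    using \<eta> n R mult_mono[of 1 "real n" 1 "real R"] by simp
  then have "0 \<le> ln (2 * real n * real R / \<eta>)"
    using \<eta> by (intro ln_ge_zero) simp
  then have \<tau>0: "0 \<le> \<tau>" and \<tau>2: "\<tau>\<^sup>2 = 2 * ln (2 * real n * real R / \<eta>) / real n"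
    by (simp_all add: \<tau>_def)
  define G where "G i l \<omega> = (\<Sum>j<n. (?h i j * q l j) * \<xi> j \<omega>)" for i l \<omega>
  have row: "(\<Sum>j<n. (?h i j * q l j)\<^sup>2) = 1 / real n" if "i < n" "l < K" for i l
  proof -
    have "(\<Sum>j<n. (?h i j * q l j)\<^sup>2) = (\<Sum>j<n. 1 / real n * (q l j)\<^sup>2)"
      using that by (intro sum.cong refl) (simp add: power_mult_distrib hadamard_entry_square n_def)
    also have "\<dots> = 1 / real n"
      using orth[OF that(2,2)] by (simp add: power2_eq_square flip: sum_distrib_left sum_divide_distrib)
    finally show ?thesis .
  qed
  let ?big = "\<lambda>i l. {\<omega> \<in> space M. \<tau> \<le> \<bar>G i l \<omega>\<bar>}"
  have tail: "?big i l \<in> events" "prob (?big i l) \<le> \<eta> / (real n * real R)"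
    if "i < n" "l < K" for i l
  proof -
    note t = rademacher_tail[OF finite_lessThan indep distr, of "\<lambda>j. ?h i j * q l j" \<tau>,
        unfolded row[OF that]]
    show "?big i l \<in> events"
      unfolding G_def using t(1) n \<tau>0 by simp
    have "prob (?big i l) \<le> 2 * exp (- \<tau>\<^sup>2 / (2 * (1 / real n)))"
      unfolding G_def using t(2) n \<tau>0 by simp
    also have "- \<tau>\<^sup>2 / (2 * (1 / real n)) = - ln (2 * real n * real R / \<eta>)"
      using n by (simp add: \<tau>2)
    also have "2 * exp \<dots> = \<eta> / (real n * real R)"
      using n R \<eta> by (simp add: exp_minus)
    finally show "prob (?big i l) \<le> \<eta> / (real n * real R)" .
  qed
  let ?L = "\<lambda>\<omega>. leverage_le R n (\<lambda>r. rand_hadamard k (\<lambda>i. \<xi> i \<omega>) *\<^sub>v b r)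
    (2 * real R * ln (2 * real n * real R / \<eta>) / real n)"
  have good: "?L \<omega>" if \<omega>: "\<omega> \<in> space M" and small: "\<And>i l. i < n \<Longrightarrow> l < K \<Longrightarrow> \<bar>G i l \<omega>\<bar> < \<tau>" for \<omega>
    unfolding leverage_le_def
  proof (intro allI impI)
    fix z :: "nat \<Rightarrow> real" and i assume i: "i < n"
    let ?y = "\<lambda>m. \<Sum>r<R. z r * (rand_hadamard k (\<lambda>i. \<xi> i \<omega>) *\<^sub>v b r) $ m"
    have y: "?y m = (\<Sum>j<n. (\<xi> j \<omega> * (\<Sum>l<K. c z l * q l j)) * ?h m j)" if "m < n" for m
    proof -
      have "?y m = (\<Sum>r<R. \<Sum>j<n. ?h m j * (\<xi> j \<omega> * (z r * b r $ j)))"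
        using b that unfolding n_def
        by (intro sum.cong refl) (simp add: rand_hadamard_mult_index sum_distrib_left mult_ac)
      also have "\<dots> = (\<Sum>j<n. (\<xi> j \<omega> * (\<Sum>r<R. z r * b r $ j)) * ?h m j)"
        by (subst sum.swap) (simp add: sum_distrib_left sum_distrib_right mult_ac)
      also have "\<dots> = (\<Sum>j<n. (\<xi> j \<omega> * (\<Sum>l<K. c z l * q l j)) * ?h m j)"
        by (intro sum.cong refl) (simp add: bc)
      finally show ?thesis .
    qed
    have sgn: "(\<xi> j \<omega>)\<^sup>2 = 1" if "j < n" for j
    proof -
      have "\<xi> j \<in> measurable M (count_space {-1, 1})"
        using indep that by (auto simp: indep_vars_def)
      then have "\<xi> j \<omega> \<in> {-1, 1}"
        using measurable_space \<omega> by (metis space_count_space)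
      then show ?thesis by auto
    qed
    have "(\<Sum>m<n. (?y m)\<^sup>2) = (\<Sum>j<n. (\<xi> j \<omega> * (\<Sum>l<K. c z l * q l j))\<^sup>2)"
      using sum_squares_orthonormal[where K = n and A = "{..<n}" and q = "\<lambda>j m. ?h m j"]
      by (simp add: y hadamard_columns_orthonormal n_def)
    also have "\<dots> = (\<Sum>j<n. (\<Sum>l<K. c z l * q l j)\<^sup>2)"
      by (simp add: power_mult_distrib sgn)
    also have "\<dots> = (\<Sum>l<K. (c z l)\<^sup>2)"
      by (rule sum_squares_orthonormal[OF orth])
    finally have norm: "(\<Sum>m<n. (?y m)\<^sup>2) = (\<Sum>l<K. (c z l)\<^sup>2)" .
    have "?y i = (\<Sum>l<K. c z l * G i l \<omega>)"
      unfolding y[OF i] G_def sum_distrib_left sum_distrib_right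
      by (subst sum.swap) (simp add: mult_ac)
    then have "(?y i)\<^sup>2 \<le> (\<Sum>l<K. (c z l)\<^sup>2) * (\<Sum>l<K. (G i l \<omega>)\<^sup>2)"
      by (simp only: Cauchy_Schwarz_ineq_sum)
    also have "\<dots> \<le> (\<Sum>l<K. (c z l)\<^sup>2) * (\<Sum>l<K. \<tau>\<^sup>2)"
    proof (intro mult_left_mono sum_mono)
      fix l assume "l \<in> {..<K}"
      then show "(G i l \<omega>)\<^sup>2 \<le> \<tau>\<^sup>2"
        using small[OF i, of l] by (intro power2_le_iff_abs_le[THEN iffD2] \<tau>0) simp
    qed (simp add: sum_nonneg)
    also have "\<dots> \<le> (\<Sum>l<K. (c z l)\<^sup>2) * (real R * \<tau>\<^sup>2)"
      using K by (intro mult_left_mono) (auto intro!: mult_right_mono sum_nonneg)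
    finally show "(?y i)\<^sup>2 \<le> 2 * real R * ln (2 * real n * real R / \<eta>) / real n * (\<Sum>m<n. (?y m)\<^sup>2)"
      unfolding norm \<tau>2 by (simp add: mult_ac)
  qed
  have "prob {\<omega> \<in> space M. \<not> ?L \<omega>} \<le> prob (\<Union>s\<in>{..<n} \<times> {..<K}. ?big (fst s) (snd s))"
  proof (rule finite_measure_mono)
    show "{\<omega> \<in> space M. \<not> ?L \<omega>} \<subseteq> (\<Union>s\<in>{..<n} \<times> {..<K}. ?big (fst s) (snd s))"
    proof (rule subsetI)
      fix \<omega> assume "\<omega> \<in> {\<omega> \<in> space M. \<not> ?L \<omega>}"
      then have \<omega>: "\<omega> \<in> space M" "\<not> ?L \<omega>" by simp_all
      then obtain i l where "i < n" "l < K" "\<not> \<bar>G i l \<omega>\<bar> < \<tau>"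
        using good by blast
      then show "\<omega> \<in> (\<Union>s\<in>{..<n} \<times> {..<K}. ?big (fst s) (snd s))"
        using \<omega> by (intro UN_I[of "(i, l)"]) auto
    qed
    show "(\<Union>s\<in>{..<n} \<times> {..<K}. ?big (fst s) (snd s)) \<in> events"
      using tail(1) by (intro sets.finite_UN) auto
  qed
  also have "\<dots> \<le> (\<Sum>s\<in>{..<n} \<times> {..<K}. prob (?big (fst s) (snd s)))"
    using tail(1) by (intro finite_measure_subadditive_finite) auto
  also have "\<dots> \<le> (\<Sum>s\<in>{..<n} \<times> {..<K}. \<eta> / (real n * real R))"
    using tail(2) by (intro sum_mono) auto
  also have "\<dots> = \<eta> * (real K / real R)"
    using n by (simp add: card_cartesian_product)
  also have "\<dots> \<le> \<eta> * 1"
    using K R \<eta> by (intro mult_left_mono) auto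
  finally show ?thesis by simp
qed

section \<open>Sampling from transformed Kronecker vectors\<close>

definition sketch_embeds ::
    "real \<Rightarrow> nat \<Rightarrow> real mat \<Rightarrow> real mat \<Rightarrow> real mat \<Rightarrow> bool" where
  "sketch_embeds \<epsilon> R S \<Phi> X \<longleftrightarrow> (\<forall>z \<in> carrier_vec R.
      (1 - \<epsilon>) * (norm2 (X *\<^sub>v z))\<^sup>2 \<le> (norm2 (S *\<^sub>v (\<Phi> *\<^sub>v (X *\<^sub>v z))))\<^sup>2 \<and>
      (norm2 (S *\<^sub>v (\<Phi> *\<^sub>v (X *\<^sub>v z))))\<^sup>2 \<le> (1 + \<epsilon>) * (norm2 (X *\<^sub>v z))\<^sup>2)"

lemma norm2_square: "y \<in> carrier_vec n \<Longrightarrow> (norm2 y)\<^sup>2 = (\<Sum>i<n. (y $ i)\<^sup>2)"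
  by (auto simp: norm2_def L2_set_def sum_nonneg)

lemma norm2_sampling_mat:
  assumes y: "y \<in> carrier_vec N" and v: "\<And>j. j < J \<Longrightarrow> v j < N"
  shows "(norm2 (sampling_mat J N v *\<^sub>v y))\<^sup>2 = real N / real J * (\<Sum>j<J. (y $ v j)\<^sup>2)"
proof -
  have idx: "(sampling_mat J N v *\<^sub>v y) $ j = sqrt (real N / real J) * y $ v j" if "j < J" for j
  proof -
    have "(sampling_mat J N v *\<^sub>v y) $ j = (sqrt (real N / real J) \<cdot>\<^sub>v unit_vec N (v j)) \<bullet> y"
      using that by (simp add: sampling_mat_def)
    also have "\<dots> = sqrt (real N / real J) * y $ v j"
      using y v[OF that] by simp
    finally show ?thesis .
  qed
  have "sampling_mat J N v *\<^sub>v y \<in> carrier_vec J"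
    by (intro carrier_vecI) (simp add: sampling_mat_def)
  then show ?thesis
    by (simp add: norm2_square idx power_mult_distrib sum_distrib_left)
qed

lemma mult_mat_vec_as_column_sum:
  fixes A :: "real mat"
  assumes "A \<in> carrier_mat n R" "z \<in> carrier_vec R" "i < n"
  shows "(A *\<^sub>v z) $ i = (\<Sum>r<R. z $ r * col A r $ i)"
  using assms by (simp add: scalar_prod_lessThan mult.commute)

lemma sum_squares_combination:
  fixes a :: "nat \<Rightarrow> real Matrix.vec"
  assumes "\<And>r. r < R \<Longrightarrow> a r \<in> carrier_vec n"
  shows "(\<Sum>i<n. (\<Sum>r<R. z r * a r $ i)\<^sup>2) = (\<Sum>r<R. \<Sum>s<R. z r * z s * (a r \<bullet> a s))"
proof -
  have "(\<Sum>i<n. (\<Sum>r<R. z r * a r $ i)\<^sup>2)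
      = (\<Sum>i<n. \<Sum>r<R. \<Sum>s<R. z r * z s * (a r $ i * a s $ i))"
    by (simp add: power2_eq_square sum_product mult_ac)
  also have "\<dots> = (\<Sum>r<R. \<Sum>i<n. \<Sum>s<R. z r * z s * (a r $ i * a s $ i))"
    by (rule sum.swap)
  also have "\<dots> = (\<Sum>r<R. \<Sum>s<R. \<Sum>i<n. z r * z s * (a r $ i * a s $ i))"
    by (rule sum.cong[OF refl], rule sum.swap)
  also have "\<dots> = (\<Sum>r<R. \<Sum>s<R. z r * z s * (a r \<bullet> a s))"
    by (intro sum.cong refl) (simp add: scalar_prod_lessThan[OF assms] sum_distrib_left)
  finally show ?thesis .
qed

text \<open>The deterministic link between the two random steps: once the signs \<open>s\<close> are fixed and good, the
columns of \<open>\<Phi> X\<close> are Kronecker vectors with the product leverage bound, and \<open>\<Phi>\<close> preserves the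
inner products of Kronecker vectors factor by factor. The second fact replaces norms of \<open>X z\<close> by norms of
\<open>\<Phi> X z\<close>.\<close>

lemma kron_rand_hadamard_sampling_count:
  fixes e :: "nat \<Rightarrow> nat" and s :: "nat \<Rightarrow> nat \<Rightarrow> real" and c :: "nat \<Rightarrow> real"
  assumes N_def: "N = (\<Prod>p<P. 2 ^ e p)" and R: "0 < R" and J: "0 < J" and \<epsilon>: "0 < \<epsilon>" "\<epsilon> < 1"
    and x: "\<And>r p. r < R \<Longrightarrow> p < P \<Longrightarrow> x r p \<in> carrier_vec (2 ^ e p)"
    and X: "X \<in> carrier_mat N R" and X_col: "\<And>r. r < R \<Longrightarrow> col X r = kron_vecs (x r) P"
    and s: "\<And>p i. p < P \<Longrightarrow> i < 2 ^ e p \<Longrightarrow> s p i \<in> {-1, 1}"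
    and c: "\<And>p. p < P \<Longrightarrow> 0 < c p"
    and lev: "\<And>p. p < P \<Longrightarrow> leverage_le R (2 ^ e p) (\<lambda>r. rand_hadamard (e p) (s p) *\<^sub>v x r p) (c p)"
  shows "real (card {v \<in> PiE {..<J} (\<lambda>_. {..<N}).
      \<not> sketch_embeds \<epsilon> R (sampling_mat J N v) (kron_mats (\<lambda>p. rand_hadamard (e p) (s p)) P) X})
    \<le> 2 * exp (- (3 * real J * \<epsilon>\<^sup>2 / (8 * (real N * (\<Prod>p<P. c p)) * real R))) * real N ^ J"
proof -
  let ?A = "\<lambda>p. rand_hadamard (e p) (s p)"
  let ?\<Phi> = "kron_mats ?A P"
  define y where "y r = (\<lambda>p. ?A p *\<^sub>v x r p)" for r
  define w where "w r = kron_vecs (y r) P" for r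
  let ?C = "\<Prod>p<P. c p"
  have N: "0 < N" by (simp add: N_def prod_pos)
  have C: "0 < ?C" using c by (intro prod_pos) auto
  have y: "y r p \<in> carrier_vec (2 ^ e p)" if "r < R" "p < P" for r p
    unfolding y_def by (rule mult_mat_vec_carrier[OF rand_hadamard_carrier x[OF that]])
  have w: "w r \<in> carrier_vec N" if "r < R" for r
    unfolding w_def N_def using y that by (intro kron_vecs_carrier) auto
  have Xc: "col X r \<in> carrier_vec N" if "r < R" for r
    using X by (intro carrier_vecI) simp
  have \<Phi>: "?\<Phi> \<in> carrier_mat N N"
    unfolding N_def by (rule kron_mats_carrier) simp
  have \<Phi>X: "?\<Phi> *\<^sub>v col X r = w r" if "r < R" for r
    unfolding X_col[OF that] w_def y_def using x that
    by (intro kron_mats_mult_kron_vecs[of _ _ "\<lambda>p. 2 ^ e p" "\<lambda>p. 2 ^ e p"]) auto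
  have ip: "w r \<bullet> w q = col X r \<bullet> col X q" if "r < R" "q < R" for r q
  proof -
    have "w r \<bullet> w q = (\<Prod>p<P. y r p \<bullet> y q p)"
      unfolding w_def using y that by (intro kron_vecs_scalar_prod[of _ _ "\<lambda>p. 2 ^ e p"]) auto
    also have "\<dots> = (\<Prod>p<P. x r p \<bullet> x q p)"
      unfolding y_def using x that s by (intro prod.cong refl rand_hadamard_scalar_prod) auto
    also have "\<dots> = col X r \<bullet> col X q"
      unfolding X_col[OF that(1)] X_col[OF that(2)] using x that
      by (intro kron_vecs_scalar_prod[of _ _ "\<lambda>p. 2 ^ e p", symmetric]) auto
    finally show ?thesis .
  qed
  have lw: "leverage_le R N w ?C"
    unfolding w_def N_def using y lev c
    by (intro leverage_le_kron_vecs) (auto simp: y_def intro: less_imp_le)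
  have embeds: "sketch_embeds \<epsilon> R (sampling_mat J N v) ?\<Phi> X"
    if v: "v \<in> PiE {..<J} (\<lambda>_. {..<N})"
      and ok: "\<And>z. \<bar>real N / real J * (\<Sum>j<J. (\<Sum>r<R. z r * w r $ v j)\<^sup>2)
        - (\<Sum>i<N. (\<Sum>r<R. z r * w r $ i)\<^sup>2)\<bar> \<le> \<epsilon> * (\<Sum>i<N. (\<Sum>r<R. z r * w r $ i)\<^sup>2)" for v
    unfolding sketch_embeds_def
  proof (rule ballI)
    fix z :: "real Matrix.vec" assume z: "z \<in> carrier_vec R"
    have Xz: "X *\<^sub>v z \<in> carrier_vec N" using X z by simp
    have \<Phi>Xz: "?\<Phi> *\<^sub>v (X *\<^sub>v z) \<in> carrier_vec N" using \<Phi> Xz by simp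
    have idx: "(?\<Phi> *\<^sub>v (X *\<^sub>v z)) $ i = (\<Sum>r<R. z $ r * w r $ i)" if "i < N" for i
    proof -
      have "(?\<Phi> *\<^sub>v (X *\<^sub>v z)) $ i = ((?\<Phi> * X) *\<^sub>v z) $ i"
        using \<Phi> X z by simp
      also have "\<dots> = (\<Sum>r<R. z $ r * col (?\<Phi> * X) r $ i)"
        by (rule mult_mat_vec_as_column_sum[OF mult_carrier_mat[OF \<Phi> X] z that])
      also have "\<dots> = (\<Sum>r<R. z $ r * w r $ i)"
        using \<Phi> X \<Phi>X by (intro sum.cong refl) (simp only: lessThan_iff col_mult2)
      finally show ?thesis .
    qed
    have "(norm2 (X *\<^sub>v z))\<^sup>2 = (\<Sum>i<N. (\<Sum>r<R. z $ r * col X r $ i)\<^sup>2)"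
      by (simp add: norm2_square[OF Xz] mult_mat_vec_as_column_sum[OF X z] del: index_mult_mat_vec)
    also have "\<dots> = (\<Sum>i<N. (\<Sum>r<R. z $ r * w r $ i)\<^sup>2)"
      using w Xc by (simp add: sum_squares_combination ip)
    finally have n1: "(norm2 (X *\<^sub>v z))\<^sup>2 = (\<Sum>i<N. (\<Sum>r<R. z $ r * w r $ i)\<^sup>2)" .
    have vN: "v j < N" if "j < J" for j using v that by (auto simp: PiE_iff)
    have n2: "(norm2 (sampling_mat J N v *\<^sub>v (?\<Phi> *\<^sub>v (X *\<^sub>v z))))\<^sup>2
        = real N / real J * (\<Sum>j<J. (\<Sum>r<R. z $ r * w r $ v j)\<^sup>2)"
      by (simp add: norm2_sampling_mat[OF \<Phi>Xz vN] idx vN del: index_mult_mat_vec)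
    show "(1 - \<epsilon>) * (norm2 (X *\<^sub>v z))\<^sup>2 \<le> (norm2 (sampling_mat J N v *\<^sub>v (?\<Phi> *\<^sub>v (X *\<^sub>v z))))\<^sup>2 \<and>
      (norm2 (sampling_mat J N v *\<^sub>v (?\<Phi> *\<^sub>v (X *\<^sub>v z))))\<^sup>2 \<le> (1 + \<epsilon>) * (norm2 (X *\<^sub>v z))\<^sup>2"
      using ok[of "\<lambda>r. z $ r"] unfolding n1 n2 by (simp add: abs_le_iff algebra_simps)
  qed
  let ?ok = "\<lambda>v. \<forall>z. \<bar>real N / real J * (\<Sum>j<J. (\<Sum>r<R. z r * w r $ v j)\<^sup>2)
        - (\<Sum>i<N. (\<Sum>r<R. z r * w r $ i)\<^sup>2)\<bar> \<le> \<epsilon> * (\<Sum>i<N. (\<Sum>r<R. z r * w r $ i)\<^sup>2)"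
  have "{v \<in> PiE {..<J} (\<lambda>_. {..<N}). \<not> sketch_embeds \<epsilon> R (sampling_mat J N v) ?\<Phi> X}
      \<subseteq> {v \<in> PiE {..<J} (\<lambda>_. {..<N}). \<not> ?ok v}"
    using embeds by blast
  moreover have "finite {v \<in> PiE {..<J} (\<lambda>_. {..<N}). \<not> ?ok v}"
    by (rule finite_subset[of _ "PiE {..<J} (\<lambda>_. {..<N})"]) (auto intro!: finite_PiE)
  ultimately have "real (card {v \<in> PiE {..<J} (\<lambda>_. {..<N}).
      \<not> sketch_embeds \<epsilon> R (sampling_mat J N v) ?\<Phi> X})
    \<le> real (card {v \<in> PiE {..<J} (\<lambda>_. {..<N}). \<not> ?ok v})"
    by (intro of_nat_mono card_mono)
  also have "\<dots> \<le> 2 * exp (- (3 * real J * \<epsilon>\<^sup>2 / (8 * (real N * ?C) * real R))) * real N ^ J"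
  proof (rule sampling_embedding_count)
    fix z :: "nat \<Rightarrow> real" and i assume "i < N"
    then have "(\<Sum>r<R. z r * w r $ i)\<^sup>2 \<le> ?C * (\<Sum>m<N. (\<Sum>r<R. z r * w r $ m)\<^sup>2)"
      using lw unfolding leverage_le_def by (elim allE) (rule mp)
    then show "real N * (\<Sum>r<R. z r * w r $ i)\<^sup>2 \<le> real N * ?C * (\<Sum>m<N. (\<Sum>r<R. z r * w r $ m)\<^sup>2)"
      unfolding mult.assoc by (rule mult_left_mono) simp
  qed (use N J R \<epsilon> C in simp_all)
  finally show ?thesis .
qed

section \<open>Independent random variables with finitely many values\<close>

lemma (in prob_space) prob_uniform_sample:
  assumes A: "finite A" and indep: "indep_vars (\<lambda>_. count_space A) v {..<J::nat}"
    and distr: "\<And>j. j < J \<Longrightarrow> distr M (count_space A) (v j) = uniform_count_measure A"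
    and J: "0 < J" and B: "B \<subseteq> PiE {..<J} (\<lambda>_. A)"
  shows "{\<omega> \<in> space M. restrict (\<lambda>j. v j \<omega>) {..<J} \<in> B} \<in> events"
    and "prob {\<omega> \<in> space M. restrict (\<lambda>j. v j \<omega>) {..<J} \<in> B} = real (card B) / real (card A) ^ J"
proof -
  have m: "v j \<in> measurable M (count_space A)" if "j < J" for j
    using indep that by (auto simp: indep_vars_def)
  have finB: "finite B"
    by (rule finite_subset[OF B]) (auto intro!: finite_PiE A)
  let ?S = "\<lambda>w. {\<omega> \<in> space M. restrict (\<lambda>j. v j \<omega>) {..<J} = w}"
  have S: "?S w = (\<Inter>j\<in>{..<J}. v j -` {w j} \<inter> space M)" if "w \<in> B" for w
  proof -
    have "w \<in> extensional {..<J}" using B that by (auto simp: PiE_def)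
    then have "restrict (\<lambda>j. v j \<omega>) {..<J} = w \<longleftrightarrow> (\<forall>j<J. v j \<omega> = w j)" for \<omega>
      by (auto simp: extensional_def restrict_def fun_eq_iff)
    then show ?thesis using J by auto
  qed
  have ev: "?S w \<in> events" if "w \<in> B" for w
    unfolding S[OF that] using J B that
    by (intro sets.finite_INT measurable_sets[OF m]) (auto simp: PiE_iff)
  have pr: "prob (?S w) = 1 / real (card A) ^ J" if "w \<in> B" for w
  proof -
    have wA: "w j \<in> A" if "j < J" for j using B \<open>w \<in> B\<close> that by (auto simp: PiE_iff)
    have "prob (?S w) = (\<Prod>j<J. prob (v j -` {w j} \<inter> space M))"
      unfolding S[OF that] using J wA by (intro indep_varsD_finite[OF indep]) auto
    also have "\<dots> = (\<Prod>j<J. 1 / real (card A))"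
    proof (intro prod.cong refl)
      fix j assume "j \<in> {..<J}"
      then have j: "j < J" by simp
      have "prob (v j -` {w j} \<inter> space M) = measure (distr M (count_space A) (v j)) {w j}"
        using wA[OF j] by (subst measure_distr[OF m[OF j]]) auto
      also have "\<dots> = 1 / real (card A)"
        unfolding distr[OF j] using A wA[OF j] by (simp add: measure_uniform_count_measure)
      finally show "prob (v j -` {w j} \<inter> space M) = 1 / real (card A)" .
    qed
    finally show ?thesis by (simp add: power_divide)
  qed
  have U: "{\<omega> \<in> space M. restrict (\<lambda>j. v j \<omega>) {..<J} \<in> B} = (\<Union>w\<in>B. ?S w)"
    by auto
  show "{\<omega> \<in> space M. restrict (\<lambda>j. v j \<omega>) {..<J} \<in> B} \<in> events"
    unfolding U using ev finB by (intro sets.finite_UN) auto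
  have "prob (\<Union>w\<in>B. ?S w) = (\<Sum>w\<in>B. prob (?S w))"
    using ev finB by (intro finite_measure_finite_Union) (auto simp: disjoint_family_on_def)
  then show "prob {\<omega> \<in> space M. restrict (\<lambda>j. v j \<omega>) {..<J} \<in> B} = real (card B) / real (card A) ^ J"
    unfolding U by (simp add: pr)
qed

lemma (in prob_space) indep_vars_reindex:
  assumes inj: "inj_on f A" and indep: "indep_vars (\<lambda>_. N) X (f ` A)"
  shows "indep_vars (\<lambda>_. N) (\<lambda>i. X (f i)) A"
  unfolding indep_vars_def
proof (intro conjI ballI)
  let ?F = "\<lambda>i. sigma_sets (space M) {X i -` B \<inter> space M |B. B \<in> sets N}"
  show "random_variable N (X (f i))" if "i \<in> A" for i
    using indep that by (auto simp: indep_vars_def)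
  have F: "indep_sets ?F (f ` A)"
    using indep by (simp add: indep_vars_def)
  show "indep_sets (\<lambda>i. ?F (f i)) A"
  proof (rule indep_setsI)
    show "?F (f i) \<subseteq> events" if "i \<in> A" for i
      using F that by (auto simp: indep_sets_def)
    fix G J assume J: "J \<noteq> {}" "J \<subseteq> A" "finite J" and G: "\<forall>j\<in>J. G j \<in> ?F (f j)"
    have inj': "inj_on f J" by (rule inj_on_subset[OF inj J(2)])
    have "prob (\<Inter>j\<in>f ` J. G (the_inv_into J f j)) = (\<Prod>j\<in>f ` J. prob (G (the_inv_into J f j)))"
      using J G by (intro indep_setsD[OF F]) (auto simp: the_inv_into_f_f[OF inj'])
    then show "prob (\<Inter>j\<in>J. G j) = (\<Prod>j\<in>J. prob (G j))"
      by (simp add: prod.reindex[OF inj'] the_inv_into_f_f[OF inj'])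
  qed
qed

text \<open>Conditioning on the finitely many values of \<open>X\<close>: independence allows fixing a good value \<open>s\<close> and
bounding the probability of the set \<open>B s\<close> for this \<open>s\<close> alone.\<close>

lemma (in prob_space) prob_bad_le_of_indep:
  assumes indep: "indep_rvs M K X L Y"
    and E: "finite E" "\<And>\<omega>. \<omega> \<in> space M \<Longrightarrow> X \<omega> \<in> E" "\<And>s. s \<in> E \<Longrightarrow> {s} \<in> sets K"
    and B: "\<And>s. s \<in> E \<Longrightarrow> B s \<in> sets L"
    and bound: "\<And>s. s \<in> E \<Longrightarrow> Q s \<Longrightarrow> prob (Y -` B s \<inter> space M) \<le> \<beta>" and \<beta>: "0 \<le> \<beta>"
  shows "{\<omega> \<in> space M. Y \<omega> \<in> B (X \<omega>)} \<in> events"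
    and "prob {\<omega> \<in> space M. Y \<omega> \<in> B (X \<omega>)} \<le> prob {\<omega> \<in> space M. \<not> Q (X \<omega>)} + \<beta>"
proof -
  have X: "X \<in> measurable M K" and Y: "Y \<in> measurable M L"
    using indep by (auto simp: indep_rvs_def)
  have Xev: "X -` {s} \<inter> space M \<in> events" if "s \<in> E" for s
    by (rule measurable_sets[OF X E(3)[OF that]])
  have Yev: "Y -` B s \<inter> space M \<in> events" if "s \<in> E" for s
    by (rule measurable_sets[OF Y B[OF that]])
  let ?ev = "\<lambda>s. (X -` {s} \<inter> space M) \<inter> (Y -` B s \<inter> space M)"
  let ?G = "{s \<in> E. Q s}"
  have "{\<omega> \<in> space M. Y \<omega> \<in> B (X \<omega>)} = (\<Union>s\<in>E. ?ev s)"
    using E(2) by auto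
  then show "{\<omega> \<in> space M. Y \<omega> \<in> B (X \<omega>)} \<in> events"
    using Xev Yev E(1) by (auto intro!: sets.finite_UN)
  have notQ: "{\<omega> \<in> space M. \<not> Q (X \<omega>)} \<in> events"
  proof -
    have eq: "{\<omega> \<in> space M. \<not> Q (X \<omega>)} = (\<Union>s\<in>{s \<in> E. \<not> Q s}. X -` {s} \<inter> space M)"
      using E(2) by auto
    show ?thesis unfolding eq using Xev E(1) by (intro sets.finite_UN) auto
  qed
  have evG: "(\<Union>s\<in>?G. ?ev s) \<in> events"
    using Xev Yev E(1) by (auto intro!: sets.finite_UN)
  have prod: "prob (?ev s) = prob (X -` {s} \<inter> space M) * prob (Y -` B s \<inter> space M)" if "s \<in> E" for s
    using indep E(3)[OF that] B[OF that] unfolding indep_rvs_def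
    by (intro indep_setD) (auto intro!: sigma_sets.Basic)
  have "prob {\<omega> \<in> space M. Y \<omega> \<in> B (X \<omega>)} \<le> prob ({\<omega> \<in> space M. \<not> Q (X \<omega>)} \<union> (\<Union>s\<in>?G. ?ev s))"
    using E(2) notQ evG by (intro finite_measure_mono) auto
  also have "\<dots> \<le> prob {\<omega> \<in> space M. \<not> Q (X \<omega>)} + prob (\<Union>s\<in>?G. ?ev s)"
    by (rule measure_Un_le[OF notQ evG])
  also have "prob (\<Union>s\<in>?G. ?ev s) \<le> (\<Sum>s\<in>?G. prob (?ev s))"
    using Xev Yev E(1) by (intro finite_measure_subadditive_finite) auto
  also have "\<dots> \<le> (\<Sum>s\<in>?G. prob (X -` {s} \<inter> space M) * \<beta>)"
    using bound by (intro sum_mono) (auto simp: prod intro!: mult_left_mono)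
  also have "\<dots> = prob (\<Union>s\<in>?G. X -` {s} \<inter> space M) * \<beta>"
    using Xev E(1) by (subst finite_measure_finite_Union) (auto simp: disjoint_family_on_def sum_distrib_right)
  also have "\<dots> \<le> 1 * \<beta>"
    using \<beta> by (intro mult_right_mono) auto
  finally show "prob {\<omega> \<in> space M. Y \<omega> \<in> B (X \<omega>)} \<le> prob {\<omega> \<in> space M. \<not> Q (X \<omega>)} + \<beta>"
    by simp
qed

lemma sets_PiM_count_space_subset:
  assumes "finite I" "\<And>i. i \<in> I \<Longrightarrow> finite (A i)" "B \<subseteq> PiE I A"
  shows "B \<in> sets (PiM I (\<lambda>i. count_space (A i)))"
proof -
  have "finite B" by (rule finite_subset[OF assms(3)]) (auto intro!: finite_PiE assms)
  moreover have "{w} \<in> sets (PiM I (\<lambda>i. count_space (A i)))" if "w \<in> B" for w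
  proof -
    have "w \<in> PiE I A" using that assms(3) by blast
    then have "{w} = PiE I (\<lambda>i. {w i})"
      by (intro PiE_singleton[symmetric]) (auto simp: PiE_def)
    also have "\<dots> \<in> sets (PiM I (\<lambda>i. count_space (A i)))"
      using assms(1) \<open>w \<in> PiE I A\<close> by (intro sets_PiM_I_finite) (auto simp: PiE_iff)
    finally show ?thesis .
  qed
  moreover have "(\<Union>w\<in>B. {w}) = B" by auto
  ultimately show ?thesis by (metis sets.finite_UN)
qed

section \<open>The random sketch\<close>

lemma mat_diag_cong: "(\<And>i. i < n \<Longrightarrow> f i = g i) \<Longrightarrow> mat_diag n f = mat_diag n g"
  unfolding mat_diag_def by (intro cong_mat) auto

lemma rand_hadamard_cong: "(\<And>i. i < 2 ^ k \<Longrightarrow> s i = t i) \<Longrightarrow> rand_hadamard k s = rand_hadamard k t"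
  unfolding rand_hadamard_def by (metis mat_diag_cong)

lemma kron_mats_cong: "(\<And>p. p < P \<Longrightarrow> A p = B p) \<Longrightarrow> kron_mats A P = kron_mats B P"
  by (induction P) auto

lemma sampling_mat_cong: "(\<And>j. j < J \<Longrightarrow> v j = w j) \<Longrightarrow> sampling_mat J N v = sampling_mat J N w"
  unfolding sampling_mat_def by (intro arg_cong[where f = "mat_of_rows N"] map_cong refl) simp

theorem theorem4p1:
  fixes M :: "'w measure"
    and P R J Itot :: nat
    and I e :: "nat \<Rightarrow> nat"
    and \<epsilon> \<delta> :: real
    and X :: "real mat"
    and x :: "nat \<Rightarrow> nat \<Rightarrow> real Matrix.vec"
    and d :: "nat \<Rightarrow> nat \<Rightarrow> 'w \<Rightarrow> real"
    and v :: "nat \<Rightarrow> 'w \<Rightarrow> nat"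
    and \<Phi> S :: "'w \<Rightarrow> real mat"
  assumes "prob_space M"
    and "P \<ge> 1" and "R \<ge> 1" and "J \<ge> 1"
    and I: "\<And>p. p < P \<Longrightarrow> I p = 2 ^ e p"
    and Itot: "Itot = (\<Prod>p<P. I p)"
    and \<epsilon>: "0 < \<epsilon>" "\<epsilon> < 1"
    and \<delta>: "0 < \<delta>" "\<delta> < 1"
    and x: "\<And>r p. r < R \<Longrightarrow> p < P \<Longrightarrow> x r p \<in> carrier_vec (I p)"
    and X: "X \<in> carrier_mat Itot R"
    and X_col: "\<And>r. r < R \<Longrightarrow> col X r = kron_vecs (x r) P"
    and d_distr: "\<And>p i. p < P \<Longrightarrow> i < I p \<Longrightarrow>
      distr M (count_space {-1, 1}) (d p i) = uniform_count_measure {-1, 1}"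
    and d_indep: "prob_space.indep_vars M (\<lambda>_. count_space {-1, 1}) (\<lambda>(p, i). d p i)
      (SIGMA p:{..<P}. {..<I p})"
    and v_distr: "\<And>j. j < J \<Longrightarrow>
      distr M (count_space {..<Itot}) (v j) = uniform_count_measure {..<Itot}"
    and v_indep: "prob_space.indep_vars M (\<lambda>_. count_space {..<Itot}) v {..<J}"
    and d_v_indep: "indep_rvs M
      (\<Pi>\<^sub>M pi\<in>(SIGMA p:{..<P}. {..<I p}). count_space {-1, 1})
      (\<lambda>\<omega>. \<lambda>(p, i)\<in>(SIGMA p:{..<P}. {..<I p}). d p i \<omega>)
      (\<Pi>\<^sub>M j\<in>{..<J}. count_space {..<Itot})
      (\<lambda>\<omega>. \<lambda>j\<in>{..<J}. v j \<omega>)"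
    and \<Phi>: "\<And>\<omega>. \<Phi> \<omega> = kron_mats (\<lambda>p. hadamard (e p) * mat_diag (I p) (\<lambda>i. d p i \<omega>)) P"
    and S: "\<And>\<omega>. S \<omega> = sampling_mat J Itot (\<lambda>j. v j \<omega>)"
    and J: "real J > 8 / 3 * 2 ^ P * real R ^ (P + 1) / \<epsilon>\<^sup>2
      * ln (2 * real R * (real P + 1) / \<delta>)
      * (\<Prod>p<P. ln (2 * real (I p) * real R * (real P + 1) / \<delta>))"
  shows "measure M {\<omega> \<in> space M. \<forall>z \<in> carrier_vec R.
      (1 - \<epsilon>) * (norm2 (X *\<^sub>v z))\<^sup>2 \<le> (norm2 (S \<omega> *\<^sub>v (\<Phi> \<omega> *\<^sub>v (X *\<^sub>v z))))\<^sup>2 \<and>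
      (norm2 (S \<omega> *\<^sub>v (\<Phi> \<omega> *\<^sub>v (X *\<^sub>v z))))\<^sup>2 \<le> (1 + \<epsilon>) * (norm2 (X *\<^sub>v z))\<^sup>2}
    \<ge> 1 - \<delta>"
proof -
  interpret prob_space M by fact
  let ?\<Sigma> = "SIGMA p:{..<P}. {..<I p}"
  let ?D = "\<lambda>\<omega>. \<lambda>(p, i)\<in>?\<Sigma>. d p i \<omega>" and ?V = "\<lambda>\<omega>. \<lambda>j\<in>{..<J}. v j \<omega>"
  \<comment> \<open>Each of the \<open>P\<close> transforms and the sampling step may fail with probability \<open>\<eta>\<close>.\<close>
  define \<eta> where "\<eta> = \<delta> / (real P + 1)"
  define \<Lambda> where "\<Lambda> p = ln (2 * real (I p) * real R * (real P + 1) / \<delta>)" for p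
  define c where "c p = 2 * real R * \<Lambda> p / real (I p)" for p
  define Q where "Q s \<longleftrightarrow> (\<forall>p<P. leverage_le R (I p) (\<lambda>r. rand_hadamard (e p) (\<lambda>i. s (p, i)) *\<^sub>v x r p) (c p))"
    for s :: "nat \<times> nat \<Rightarrow> real"
  define \<Psi> where "\<Psi> s = kron_mats (\<lambda>p. rand_hadamard (e p) (\<lambda>i. s (p, i))) P" for s :: "nat \<times> nat \<Rightarrow> real"
  define B where "B s = {w \<in> PiE {..<J} (\<lambda>_. {..<Itot}). \<not> sketch_embeds \<epsilon> R (sampling_mat J Itot w) (\<Psi> s) X}"
    for s
  have R0: "0 < R" and J0: "0 < J" using \<open>R \<ge> 1\<close> \<open>J \<ge> 1\<close> by auto
  have I0: "0 < I p" if "p < P" for p using I[OF that] by simp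
  have \<eta>: "0 < \<eta>" "\<eta> \<le> 1" using \<delta> by (auto simp: \<eta>_def)
  have finS: "finite ?\<Sigma>" by auto
  have gt1: "1 < 2 * y * real R * (real P + 1) / \<delta>" if "1 \<le> y" for y
  proof -
    have "1 * 1 * 1 \<le> y * real R * (real P + 1)"
      using that R0 by (intro mult_mono) auto
    then have "\<delta> < 2 * y * real R * (real P + 1)" using \<delta> by simp
    then show ?thesis using \<delta> by simp
  qed
  have \<Lambda>0: "0 < \<Lambda> p" if "p < P" for p
    unfolding \<Lambda>_def using gt1[of "real (I p)"] I0[OF that] by (intro ln_gt_zero) simp
  have c0: "0 < c p" if "p < P" for p
    unfolding c_def using \<Lambda>0[OF that] I0[OF that] R0 by simp
  have D_meas: "?D \<in> measurable M (PiM ?\<Sigma> (\<lambda>_. count_space {-1, 1}))"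
    using d_v_indep unfolding indep_rvs_def by blast
  have Dval: "?D \<omega> \<in> PiE ?\<Sigma> (\<lambda>_. {-1, 1})" if "\<omega> \<in> space M" for \<omega>
    using measurable_space[OF D_meas that] by (simp only: space_PiM space_count_space)
  have Vval: "?V \<omega> \<in> PiE {..<J} (\<lambda>_. {..<Itot})" if "\<omega> \<in> space M" for \<omega>
  proof -
    have "?V \<in> measurable M (PiM {..<J} (\<lambda>_. count_space {..<Itot}))"
      using d_v_indep by (simp add: indep_rvs_def)
    from measurable_space[OF this that] show ?thesis by (simp add: space_PiM)
  qed
  have \<Phi>_eq: "\<Phi> \<omega> = \<Psi> (?D \<omega>)" for \<omega>
    unfolding \<Phi> \<Psi>_def rand_hadamard_def using I
    by (intro kron_mats_cong arg_cong2[where f = "(*)"] refl) (auto intro!: mat_diag_cong)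
  have S_eq: "S \<omega> = sampling_mat J Itot (?V \<omega>)" for \<omega>
    unfolding S by (rule sampling_mat_cong) simp
  have "{\<omega> \<in> space M. ?V \<omega> \<in> B (?D \<omega>)} = {\<omega> \<in> space M. \<not> sketch_embeds \<epsilon> R (S \<omega>) (\<Phi> \<omega>) X}"
    using Vval unfolding B_def \<Phi>_eq S_eq by blast
  then have compl: "space M - {\<omega> \<in> space M. ?V \<omega> \<in> B (?D \<omega>)} = {\<omega> \<in> space M. sketch_embeds \<epsilon> R (S \<omega>) (\<Phi> \<omega>) X}"
    by blast
  \<comment> \<open>The sampling step for fixed good signs \<open>s\<close>.\<close>
  have sample: "prob (?V -` B s \<inter> space M) \<le> \<eta>" if s: "s \<in> PiE ?\<Sigma> (\<lambda>_. {-1, 1})" and Qs: "Q s" for s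
  proof -
    let ?C = "real Itot * (\<Prod>p<P. c p)"
    have "?C = (\<Prod>p<P. real (I p) * c p)"
      by (simp add: Itot prod.distrib)
    also have "\<dots> = (\<Prod>p<P. 2 * real R * \<Lambda> p)"
      using I0 by (intro prod.cong refl) (auto simp: c_def)
    also have "\<dots> = 2 ^ P * real R ^ P * (\<Prod>p<P. \<Lambda> p)"
      by (simp add: prod.distrib power_mult_distrib)
    finally have C: "?C = 2 ^ P * real R ^ P * (\<Prod>p<P. \<Lambda> p)" .
    have C0: "0 < ?C"
      unfolding C using \<Lambda>0 R0 by (intro mult_pos_pos prod_pos) auto
    \<comment> \<open>The hypothesis on \<open>J\<close> is what makes the exponent at least \<open>l\<close>; here \<open>?C\<close> is \<open>B\<close> of the introduction.\<close>
    define l where "l = ln (2 * real R * (real P + 1) / \<delta>)"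
    have "8 / 3 * ?C * real R / \<epsilon>\<^sup>2 * l < real J"
      using J unfolding C \<Lambda>_def l_def by (simp add: mult_ac)
    then have "l * (8 * ?C * real R) \<le> 3 * real J * \<epsilon>\<^sup>2"
      using \<epsilon> by (simp add: field_simps)
    moreover have "0 < 8 * ?C * real R"
      using C0 R0 by simp
    ultimately have "l \<le> 3 * real J * \<epsilon>\<^sup>2 / (8 * ?C * real R)"
      by (simp only: pos_le_divide_eq)
    then have "exp (- (3 * real J * \<epsilon>\<^sup>2 / (8 * ?C * real R))) \<le> exp (- l)"
      by simp
    also have "exp (- l) = \<delta> / (2 * real R * (real P + 1))"
      using gt1[of 1] by (simp add: l_def exp_minus)
    also have "\<dots> \<le> \<delta> / (2 * (real P + 1))"
      using R0 \<delta> by (intro divide_left_mono mult_right_mono) auto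
    finally have small: "2 * exp (- (3 * real J * \<epsilon>\<^sup>2 / (8 * ?C * real R))) \<le> \<eta>"
      by (simp add: \<eta>_def field_simps)
    have "prob (?V -` B s \<inter> space M) = prob {\<omega> \<in> space M. ?V \<omega> \<in> B s}"
      by (rule arg_cong[where f = prob]) auto
    also have "\<dots> = real (card (B s)) / real (card {..<Itot}) ^ J"
      by (rule prob_uniform_sample[OF _ v_indep v_distr J0]) (auto simp: B_def)
    also have "\<dots> \<le> 2 * exp (- (3 * real J * \<epsilon>\<^sup>2 / (8 * ?C * real R))) * real Itot ^ J / real Itot ^ J"
    proof -
      have "real (card (B s)) \<le> 2 * exp (- (3 * real J * \<epsilon>\<^sup>2 / (8 * ?C * real R))) * real Itot ^ J"
        unfolding B_def \<Psi>_def
      proof (rule kron_rand_hadamard_sampling_count[OF _ R0 J0 \<epsilon> _ X X_col _ c0])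
        show "Itot = (\<Prod>p<P. 2 ^ e p)" using I by (simp add: Itot)
        show "x r p \<in> carrier_vec (2 ^ e p)" if "r < R" "p < P" for r p
          using x[OF that] I that by simp
        show "s (p, i) \<in> {-1, 1}" if "p < P" "i < 2 ^ e p" for p i
          using s that I by (auto simp: PiE_iff)
        show "leverage_le R (2 ^ e p) (\<lambda>r. rand_hadamard (e p) (\<lambda>i. s (p, i)) *\<^sub>v x r p) (c p)" if "p < P" for p
          using Qs that I unfolding Q_def by simp
      qed
      then show ?thesis unfolding card_lessThan by (rule divide_right_mono) simp
    qed
    also have "\<dots> \<le> \<eta>"
      using small C0 by (cases "Itot = 0") simp_all
    finally show ?thesis .
  qed
  have "prob {\<omega> \<in> space M. \<not> Q (?D \<omega>)} \<le> real P * \<eta>"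
  proof -
    let ?bad = "\<lambda>p. {\<omega> \<in> space M. \<not> leverage_le R (I p) (\<lambda>r. rand_hadamard (e p) (\<lambda>i. d p i \<omega>) *\<^sub>v x r p) (c p)}"
    have bad: "prob (?bad p) \<le> \<eta>" if p: "p < P" for p
    proof -
      have "indep_vars (\<lambda>_. count_space {-1, 1}) (\<lambda>i. case (p, i) of (p, i) \<Rightarrow> d p i) {..<I p}"
        by (rule indep_vars_reindex[OF _ indep_vars_subset[OF d_indep]]) (use p in \<open>auto simp: inj_on_def\<close>)
      then have indep: "indep_vars (\<lambda>_. count_space {-1, 1}) (d p) {..<I p}"
        by simp
      have "prob {\<omega> \<in> space M. \<not> leverage_le R (I p) (\<lambda>r. rand_hadamard (e p) (\<lambda>i. d p i \<omega>) *\<^sub>v x r p)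
         (2 * real R * ln (2 * real (I p) * real R / \<eta>) / real (I p))} \<le> \<eta>"
        by (rule rand_hadamard_leverage[OF I[OF p] indep d_distr[OF p] x[OF _ p] R0 \<eta>])
      then show ?thesis unfolding c_def \<Lambda>_def \<eta>_def by simp
    qed
    have rand_hadamard_D: "rand_hadamard (e p) (\<lambda>i. ?D \<omega> (p, i)) = rand_hadamard (e p) (\<lambda>i. d p i \<omega>)" if "p < P" for p \<omega>
      using I[OF that] that by (intro rand_hadamard_cong) simp
    have ev: "?bad p \<in> events" if p: "p < P" for p
    proof -
      let ?E = "{s \<in> PiE ?\<Sigma> (\<lambda>_. {-1, 1}).
          \<not> leverage_le R (I p) (\<lambda>r. rand_hadamard (e p) (\<lambda>i. s (p, i)) *\<^sub>v x r p) (c p)}"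
      have "?E \<in> sets (PiM ?\<Sigma> (\<lambda>_. count_space {-1, 1}))"
        using finS by (intro sets_PiM_count_space_subset) auto
      with D_meas have "?D -` ?E \<inter> space M \<in> events"
        by (rule measurable_sets)
      also have "?D -` ?E \<inter> space M = {\<omega> \<in> space M. ?D \<omega> \<in> ?E}"
        by blast
      also have "\<dots> = ?bad p"
        unfolding mem_Collect_eq rand_hadamard_D[OF p] using Dval by blast
      finally show ?thesis .
    qed
    have "{\<omega> \<in> space M. \<not> Q (?D \<omega>)} = (\<Union>p<P. ?bad p)"
      unfolding Q_def by (simp add: rand_hadamard_D del: split_paired_All restrict_apply) blast
    also have "prob \<dots> \<le> (\<Sum>p<P. prob (?bad p))"
      using ev by (intro finite_measure_subadditive_finite) auto
    also have "\<dots> \<le> (\<Sum>p<P. \<eta>)"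
      using bad by (intro sum_mono) auto
    finally show ?thesis by simp
  qed
  moreover have "prob {\<omega> \<in> space M. ?V \<omega> \<in> B (?D \<omega>)} \<le> prob {\<omega> \<in> space M. \<not> Q (?D \<omega>)} + \<eta>"
    and ev: "{\<omega> \<in> space M. ?V \<omega> \<in> B (?D \<omega>)} \<in> events"
  proof -
    have E1: "finite (PiE ?\<Sigma> (\<lambda>_. {-1, 1 :: real}))"
      using finS by (intro finite_PiE) auto
    have E2: "{s} \<in> sets (PiM ?\<Sigma> (\<lambda>_. count_space {-1, 1}))" if "s \<in> PiE ?\<Sigma> (\<lambda>_. {-1, 1 :: real})" for s
      using finS that by (intro sets_PiM_count_space_subset) auto
    have E3: "B s \<in> sets (PiM {..<J} (\<lambda>_. count_space {..<Itot}))" for s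
      by (intro sets_PiM_count_space_subset) (auto simp: B_def)
    note bad = prob_bad_le_of_indep[OF d_v_indep E1 Dval E2 E3 sample less_imp_le[OF \<eta>(1)]]
    show "prob {\<omega> \<in> space M. ?V \<omega> \<in> B (?D \<omega>)} \<le> prob {\<omega> \<in> space M. \<not> Q (?D \<omega>)} + \<eta>"
      by (rule bad(2))
    show "{\<omega> \<in> space M. ?V \<omega> \<in> B (?D \<omega>)} \<in> events"
      by (rule bad(1))
  qed
  moreover have "real P * \<eta> + \<eta> = \<delta>"
  proof -
    have "real P + 1 \<noteq> 0" by linarith
    then have "(real P + 1) * \<eta> = \<delta>" unfolding \<eta>_def by simp
    then show ?thesis by (simp add: distrib_right)
  qed
  ultimately have "prob {\<omega> \<in> space M. ?V \<omega> \<in> B (?D \<omega>)} \<le> \<delta>"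
    by linarith
  then have "1 - \<delta> \<le> prob (space M - {\<omega> \<in> space M. ?V \<omega> \<in> B (?D \<omega>)})"
    using prob_compl[OF ev] by simp
  then show ?thesis unfolding compl sketch_embeds_def .
qed

end
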